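(* Let $\Omega\subset\mathbb{R}^d$ be a bounded Lipschitz domain, $N\in\mathbb{N}$, $D=Nd$, $\mathcal{D}=\mathbb{R}^D$, and write $\vec{q}=(\vec{q}_1,\dots,\vec{q}_N)$ with $\vec{q}_n\in\mathbb{R}^d$. Let $\mathcal{Z}$ be the set of block-diagonal symmetric positive definite $D\times D$ matrices with $N$ blocks of size $d\times d$, $\tilde{\mathcal{Z}}$ the space of block-diagonal symmetric $D\times D$ matrices with $N$ blocks of size $d\times d$, and $\Phi(\mathcal{C},\vec{q})=\exp(-\tfrac12\vec{q}^\top\mathcal{C}^{-1}\vec{q})/\sqrt{(2\pi)^D\det\mathcal{C}}$. Let $\mathcal{M}_\Phi=\{f\in\mathcal{H}: f(\vec{x},\vec{q})=\Phi(\mathcal{C}(\vec{x}),\vec{q}),\ \mathcal{C}:\Omega\to\mathcal{Z}\}$ and consider $f\in\mathcal{M}_\Phi$ with $f(\vec{x},\vec{q})=\Phi(\mathcal{C}(\vec{x}),\vec{q})$, $\mathcal{C}(\vec{x})\in\mathcal{Z}$ (smooth in $\vec{x}$). Then: (i) The tangent space of $\mathcal{M}_\Phi$ at $f$ is $$T_f\mathcal{M}_\Phi=\Big\{\varphi\in\mathcal{H}:\ \varphi(\vec{x},\vec{q})=\big(\vec{q}^\top A(\vec{x})\vec{q}-\operatorname{tr}(A(\vec{x})\mathcal{C}(\vec{x}))\big)f(\vec{x},\vec{q}),\ A:\Omega\to\tilde{\mathcal{Z}}\Big\}.$$ (ii) The configurational operator $\mathcal{L}_{\vec{q}}(t)\varphi=-\operatorname{div}_{\vec{q}}\big(M(t)\vec{q}\,\varphi+\tfrac{1}{2\mathrm{De}}(\Lambda\otimes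 I_d)\nabla_{\vec{q}}\varphi\big)$ satisfies $\mathcal{L}_{\vec{q}}(t)f\in T_f\mathcal{M}_\Phi$; more precisely $$\mathcal{L}_{\vec{q}}(t)f=\big(\vec{q}^\top A_{\vec{q}}(t)\vec{q}-\operatorname{tr}(A_{\vec{q}}(t)\mathcal{C})\big)f,$$ where $A_{\vec{q}}(t,\vec{x})\in\tilde{\mathcal{Z}}$ is $$A_{\vec{q}}(t,\vec{x})=\tfrac12\mathcal{C}(\vec{x})^{-1}\Big(M(t,\vec{x})\mathcal{C}(\vec{x})+\mathcal{C}(\vec{x})M(t,\vec{x})^\top-\tfrac{1}{\mathrm{De}}\Lambda\otimes I_d\Big)\mathcal{C}(\vec{x})^{-1}.$$ (iii) The spatial operator $\mathcal{L}_{\vec{x}}(t)=\vec{u}(t)\cdot\nabla_{\vec{x}}-\varepsilon\Delta_{\vec{x}}$ satisfies $$\mathcal{L}_{\vec{x}}(t)f=\big(\vec{q}^\top A_{\vec{x}}(t)\vec{q}-\operatorname{tr}(A_{\vec{x}}(t)\mathcal{C})\big)f+\varepsilon\rho f,$$ where $A_{\vec{x}}(t,\vec{x})=\tfrac12\mathcal{C}(\vec{x})^{-1}\big(\mathcal{L}_{\vec{x}}(t)\mathcal{C}(\vec{x})\big)\mathcal{C}(\vec{x})^{-1}\in\tilde{\mathcal{Z}}$ (with $\mathcal{L}_{\vec{x}}(t)$ acting entrywise on $\mathcal{C}$) and $$\rho(\vec{x},\vec{q})=\sum_{i=1}^d\vec{q}^\top\big(\mathcal{C}^{-1}\partial_{x_i}\mathcal{C}\big)^2\mathcal{C}^{-1}\vec{q}-\tfrac12\sum_{i=1}^d\operatorname{tr}\big((\mathcal{C}^{-1}\partial_{x_i}\mathcal{C})^2\big)-\tfrac14\sum_{i=1}^d\Big[\vec{q}^\top\mathcal{C}^{-1}\partial_{x_i}\mathcal{C}\,\mathcal{C}^{-1}\vec{q}-\operatorname{tr}(\mathcal{C}^{-1}\partial_{x_i}\mathcal{C})\Big]^2,$$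 with $\mathcal{C}=\mathcal{C}(\vec{x})$. In particular, if $\varepsilon=0$ then $\mathcal{L}_{\vec{x}}(t)f\in T_f\mathcal{M}_\Phi$.
   Context: $\mathcal{H}$ is the Maxwellian-weighted Sobolev space of functions on $\Omega\times\mathcal{D}$ with norm $\big(\int_\Omega\int_{\mathcal{D}}(|\varphi|^2+|\nabla_{\vec{x}}\varphi|^2+|\nabla_{\vec{q}}\varphi|^2)e^{-|\vec{q}|^2/2}\,\mathrm{d}\vec{q}\,\mathrm{d}\vec{x}\big)^{1/2}$. $\vec{u}(t,\vec{x})\in\mathbb{R}^d$ is a given smooth velocity field, $\nabla_{\vec{x}}\vec{u}$ its Jacobian matrix, $\varepsilon>0$ (or $\ge0$) a diffusion coefficient, $\mathrm{De}>0$ the Deborah number. $R=\mathrm{tridiag}(-1,2,-1)\in\mathbb{R}^{N\times N}$ is the Rouse matrix with eigendecomposition $R=Q^\top\Lambda Q$, $\Lambda=\mathrm{diag}(\lambda_1,\dots,\lambda_N)$, and $M(t,\vec{x})=\frac{1}{2\mathrm{De}}\Lambda\otimes I_d-I_N\otimes\nabla_{\vec{x}}\vec{u}(t,\vec{x})\in\mathbb{R}^{D\times D}$. $I_k$ denotes the $k\times k$ identity. *)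

theory Defs
  imports "HOL-Analysis.Analysis"
begin

definition lipschitz_domain :: "(real^'d::finite) set \<Rightarrow> bool" where
  "lipschitz_domain \<Omega> \<longleftrightarrow> open \<Omega> \<and> connected \<Omega> \<and> \<Omega> \<noteq> {} \<and>
     (\<forall>p\<in>frontier \<Omega>. \<exists>e r L (g :: real^'d \<Rightarrow> real).
        norm e = 1 \<and> r > 0 \<and> L-lipschitz_on UNIV g \<and>
        (\<forall>y. g y = g (y - (y \<bullet> e) *\<^sub>R e)) \<and>
        (\<forall>y\<in>ball p r. y \<in> \<Omega> \<longleftrightarrow> (y - p) \<bullet> e < g (y - p)))"

fun Ck :: "nat \<Rightarrow> 'a::euclidean_space set \<Rightarrow> ('a \<Rightarrow> 'b::euclidean_space) \<Rightarrow> bool" where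
  "Ck 0 S f = continuous_on S f"
| "Ck (Suc k) S f = (f differentiable_on S \<and>
      (\<forall>b\<in>Basis. Ck k S (\<lambda>x. frechet_derivative f (at x) b)))"

definition smooth_on :: "'a::euclidean_space set \<Rightarrow> ('a \<Rightarrow> 'b::euclidean_space) \<Rightarrow> bool" where
  "smooth_on S f \<longleftrightarrow> (\<forall>k. Ck k S f)"

definition pd :: "'k::finite \<Rightarrow> (real^'k \<Rightarrow> real) \<Rightarrow> real^'k \<Rightarrow> real" where
  "pd k g y = deriv (\<lambda>s. g (y + s *\<^sub>R axis k 1)) 0"

definition grad :: "(real^'k::finite \<Rightarrow> real) \<Rightarrow> real^'k \<Rightarrow> real^'k" where
  "grad g y = (\<chi> k. pd k g y)"

definition lap :: "(real^'k::finite \<Rightarrow> real) \<Rightarrow> real^'k \<Rightarrow> real" where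
  "lap g y = (\<Sum>k\<in>UNIV. pd k (pd k g) y)"

text \<open>Functions on \<Omega> x R^D, D = N d, with q = (q_1,..,q_N) indexed by ('n,'d).
  Weak derivatives are tested against C^1 functions with compact support in \<Omega> x R^D.\<close>

definition test_fn :: "('a::euclidean_space) set \<Rightarrow> ('a \<Rightarrow> real) \<Rightarrow> ('a \<Rightarrow> 'a \<Rightarrow> real) \<Rightarrow> bool" where
  "test_fn U \<psi> \<psi>' \<longleftrightarrow> (\<forall>z. (\<psi> has_derivative \<psi>' z) (at z)) \<and>
      (\<forall>v. continuous_on UNIV (\<lambda>z. \<psi>' z v)) \<and>
      (\<exists>K. compact K \<and> K \<subseteq> U \<and> (\<forall>z. z \<notin> K \<longrightarrow> \<psi> z = 0))"

definition weak_grad :: "('a::euclidean_space) set \<Rightarrow> ('a \<Rightarrow> real) \<Rightarrow> ('a \<Rightarrow> 'a \<Rightarrow> real) \<Rightarrow> bool" where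
  "weak_grad U \<phi> g \<longleftrightarrow>
     (\<forall>K. compact K \<and> K \<subseteq> U \<longrightarrow> set_integrable lborel K \<phi> \<and>
          (\<forall>b\<in>Basis. set_integrable lborel K (\<lambda>z. g z b))) \<and>
     (\<forall>\<psi> \<psi>'. test_fn U \<psi> \<psi>' \<longrightarrow>
        (\<forall>b\<in>Basis. (\<integral>z. \<phi> z * \<psi>' z b \<partial>lborel) = - (\<integral>z. g z b * \<psi> z \<partial>lborel)))"

definition Hspace :: "(real^'d::finite) set \<Rightarrow> (((real^'d) \<times> (real^('n::finite \<times> 'd))) \<Rightarrow> real) set" where
  "Hspace \<Omega> = {\<phi>. \<phi> \<in> borel_measurable lborel \<and>
     (\<exists>g. weak_grad (\<Omega> \<times> UNIV) \<phi> g \<and>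
        (\<integral>\<^sup>+ z. indicator (\<Omega> \<times> UNIV) z *
            ennreal (((\<phi> z)\<^sup>2 + (\<Sum>b\<in>Basis. (g z b)\<^sup>2)) * exp (- (norm (snd z))\<^sup>2 / 2)) \<partial>lborel) < \<infinity>)}"

definition block_diag :: "real^('n::finite \<times> 'd::finite)^('n \<times> 'd) \<Rightarrow> bool" where
  "block_diag A \<longleftrightarrow> (\<forall>i a j b. i \<noteq> j \<longrightarrow> A $ (i,a) $ (j,b) = 0)"

definition Zset :: "(real^('n::finite \<times> 'd::finite)^('n \<times> 'd)) set" where
  "Zset = {C. block_diag C \<and> transpose C = C \<and> (\<forall>v. v \<noteq> 0 \<longrightarrow> v \<bullet> (C *v v) > 0)}"

definition Ztilde :: "(real^('n::finite \<times> 'd::finite)^('n \<times> 'd)) set" where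
  "Ztilde = {A. block_diag A \<and> transpose A = A}"

definition diag_mat :: "real^'n::finite \<Rightarrow> real^'n^'n" where
  "diag_mat v = (\<chi> i j. if i = j then v $ i else 0)"

text \<open>Kronecker products  \<Lambda> \<otimes> I_d  and  I_N \<otimes> G  (q ordered bead-major).\<close>
definition kron_I :: "real^'n::finite^'n \<Rightarrow> real^('n \<times> 'd::finite)^('n \<times> 'd)" where
  "kron_I L = (\<chi> p r. L $ fst p $ fst r * (if snd p = snd r then 1 else 0))"

definition I_kron :: "real^'d::finite^'d \<Rightarrow> real^('n::finite \<times> 'd)^('n \<times> 'd)" where
  "I_kron G = (\<chi> p r. (if fst p = fst r then 1 else 0) * G $ snd p $ snd r)"

definition adjacent :: "'n::linorder \<Rightarrow> 'n \<Rightarrow> bool" where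
  "adjacent i j \<longleftrightarrow> i \<noteq> j \<and> \<not> (\<exists>k. min i j < k \<and> k < max i j)"

definition rouse :: "real^('n::{finite,linorder})^('n::{finite,linorder})" where
  "rouse = (\<chi> i j. if i = j then 2 else if adjacent i j then -1 else 0)"

definition Phi :: "real^('n::finite \<times> 'd::finite)^('n \<times> 'd) \<Rightarrow> real^('n \<times> 'd) \<Rightarrow> real" where
  "Phi C q = exp (- (q \<bullet> (matrix_inv C *v q)) / 2) /
             sqrt ((2 * pi) ^ CARD('n \<times> 'd) * det C)"

definition M_Phi :: "(real^'d::finite) set \<Rightarrow> (((real^'d) \<times> (real^('n::finite \<times> 'd))) \<Rightarrow> real) set" where
  "M_Phi \<Omega> = {f \<in> Hspace \<Omega>. \<exists>C. (\<forall>x\<in>\<Omega>. C x \<in> Zset) \<and>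
                       (\<forall>x\<in>\<Omega>. \<forall>q. f (x,q) = Phi (C x) q)}"

text \<open>Tangent space of M_Phi at f: elements of H arising as (pointwise) velocities
  at s = 0 of curves s \<mapsto> Phi(\<gamma> s) of Z-valued parameter fields through f.\<close>
definition tangent_space :: "(real^'d::finite) set \<Rightarrow> (((real^'d) \<times> (real^('n::finite \<times> 'd))) \<Rightarrow> real)
     \<Rightarrow> (((real^'d) \<times> (real^('n \<times> 'd))) \<Rightarrow> real) set" where
  "tangent_space \<Omega> f = {\<phi> \<in> Hspace \<Omega>. \<exists>\<gamma> :: real \<Rightarrow> real^'d \<Rightarrow> real^('n \<times> 'd)^('n \<times> 'd).
      (\<forall>s. \<forall>x\<in>\<Omega>. \<gamma> s x \<in> Zset) \<and>
      (\<forall>x\<in>\<Omega>. \<forall>q. Phi (\<gamma> 0 x) q = f (x,q)) \<and>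
      (\<forall>x\<in>\<Omega>. \<forall>q. ((\<lambda>s. Phi (\<gamma> s x) q) has_real_derivative \<phi> (x,q)) (at 0))}"

definition Mmat :: "real \<Rightarrow> real^'n::finite^'n \<Rightarrow> (real \<Rightarrow> real^'d::finite \<Rightarrow> real^'d) \<Rightarrow> real \<Rightarrow> real^'d
     \<Rightarrow> real^('n \<times> 'd)^('n \<times> 'd)" where
  "Mmat De \<Lambda> u t x = (1 / (2 * De)) *\<^sub>R kron_I \<Lambda> - I_kron (jacobian (u t) (at x))"

definition Lq :: "real \<Rightarrow> real^'n::finite^'n \<Rightarrow> (real \<Rightarrow> real^'d::finite \<Rightarrow> real^'d) \<Rightarrow> real
     \<Rightarrow> (((real^'d) \<times> (real^('n \<times> 'd))) \<Rightarrow> real) \<Rightarrow> ((real^'d) \<times> (real^('n \<times> 'd))) \<Rightarrow> real" where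
  "Lq De \<Lambda> u t \<phi> z = (let x = fst z in
     - (\<Sum>k\<in>UNIV. pd k (\<lambda>q'. (Mmat De \<Lambda> u t x *v q') $ k * \<phi> (x,q')
          + (1 / (2 * De)) * ((kron_I \<Lambda> :: real^('n \<times> 'd)^('n \<times> 'd)) *v grad (\<lambda>q''. \<phi> (x,q'')) q') $ k)
         (snd z)))"

definition Lx :: "(real \<Rightarrow> real^'d::finite \<Rightarrow> real^'d) \<Rightarrow> real \<Rightarrow> real
     \<Rightarrow> (((real^'d) \<times> 'q) \<Rightarrow> real) \<Rightarrow> ((real^'d) \<times> 'q) \<Rightarrow> real" where
  "Lx u \<epsilon> t \<phi> z = u t (fst z) \<bullet> grad (\<lambda>x'. \<phi> (x', snd z)) (fst z)
                   - \<epsilon> * lap (\<lambda>x'. \<phi> (x', snd z)) (fst z)"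

definition Lx_mat :: "(real \<Rightarrow> real^'d::finite \<Rightarrow> real^'d) \<Rightarrow> real \<Rightarrow> real
     \<Rightarrow> (real^'d \<Rightarrow> real^'m::finite^'m) \<Rightarrow> real^'d \<Rightarrow> real^'m^'m" where
  "Lx_mat u \<epsilon> t C x = (\<chi> i j. u t x \<bullet> grad (\<lambda>x'. C x' $ i $ j) x
                                - \<epsilon> * lap (\<lambda>x'. C x' $ i $ j) x)"

definition dmat :: "'d::finite \<Rightarrow> (real^'d \<Rightarrow> real^'m::finite^'m) \<Rightarrow> real^'d \<Rightarrow> real^'m^'m" where
  "dmat a C x = (\<chi> i j. pd a (\<lambda>x'. C x' $ i $ j) x)"

definition Aq :: "real \<Rightarrow> real^'n::finite^'n \<Rightarrow> (real \<Rightarrow> real^'d::finite \<Rightarrow> real^'d) \<Rightarrow> real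
     \<Rightarrow> (real^'d \<Rightarrow> real^('n \<times> 'd)^('n \<times> 'd)) \<Rightarrow> real^'d \<Rightarrow> real^('n \<times> 'd)^('n \<times> 'd)" where
  "Aq De \<Lambda> u t C x = (1/2) *\<^sub>R (matrix_inv (C x) **
      (Mmat De \<Lambda> u t x ** C x + C x ** transpose (Mmat De \<Lambda> u t x) - (1 / De) *\<^sub>R kron_I \<Lambda>)
      ** matrix_inv (C x))"

definition Ax :: "(real \<Rightarrow> real^'d::finite \<Rightarrow> real^'d) \<Rightarrow> real \<Rightarrow> real
     \<Rightarrow> (real^'d \<Rightarrow> real^'m::finite^'m) \<Rightarrow> real^'d \<Rightarrow> real^'m^'m" where
  "Ax u \<epsilon> t C x = (1/2) *\<^sub>R (matrix_inv (C x) ** Lx_mat u \<epsilon> t C x ** matrix_inv (C x))"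

definition rho :: "(real^'d::finite \<Rightarrow> real^'m::finite^'m) \<Rightarrow> real^'d \<Rightarrow> real^'m \<Rightarrow> real" where
  "rho C x q = (\<Sum>a\<in>UNIV. let B = matrix_inv (C x) ** dmat a C x in
       q \<bullet> ((B ** B ** matrix_inv (C x)) *v q) - (1/2) * trace (B ** B)
       - (1/4) * (q \<bullet> ((B ** matrix_inv (C x)) *v q) - trace B)\<^sup>2)"

end

theory Submission
  imports Defs
begin

(* Along any curve s -> C(s) of covariance matrices, Jacobi's formula for det and
   d(C^-1) = -C^-1 C' C^-1 give d/ds Phi(C(s), q) = (q^T A q - tr (A C)) Phi(C, q) with
   A = C^-1 C' C^-1 / 2, a symmetric block-diagonal matrix. Conversely every such A arises in
   this way from the congruence curve (1 + s C A) C (1 + s C A)^T, and a curve along which all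
   values Phi(C(s), q) are differentiable has differentiable inverse C(s)^-1, because the
   quadratic forms q^T C(s)^-1 q = -2 log (Phi(C(s), q) / Phi(C(s), 0)) determine it by
   polarisation.
   For L_q, the identity grad_q Phi = -Phi C^-1 q turns the flux into Phi G q with
   G = M - (2 De)^-1 (Lambda (x) I_d) C^-1, whose divergence ((G q).(C^-1 q) - tr G) Phi is the
   tangent vector of the velocity G C + C G^T. For L_x, the first x-derivatives of f are the
   tangent vectors of the partial derivatives of C; the second derivatives contribute in
   addition the square of the first logarithmic derivative and the derivative of C^-1, and
   these extra terms are exactly rho. *)

section \<open>Matrix algebra\<close>

lemma matrix_add_rdistrib: "((A::'a::semiring_1^'n^'m) + B) ** C = A ** C + B ** C"
  by (simp add: vec_eq_iff matrix_matrix_mult_def sum.distrib algebra_simps)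

lemma matrix_diff_ldistrib: "(A::'a::ring_1^'n^'m) ** (B - C) = A ** B - A ** C"
  by (simp add: vec_eq_iff matrix_matrix_mult_def sum_subtractf algebra_simps)

lemma matrix_diff_rdistrib: "((A::'a::ring_1^'n^'m) - B) ** C = A ** C - B ** C"
  by (simp add: vec_eq_iff matrix_matrix_mult_def sum_subtractf algebra_simps)

lemma matrix_uminus_left: "(- (A::'a::ring_1^'n^'m)) ** B = - (A ** B)"
  by (simp add: vec_eq_iff matrix_matrix_mult_def sum_negf)

lemma matrix_uminus_right: "(A::'a::ring_1^'n^'m) ** (- B) = - (A ** B)"
  by (simp add: vec_eq_iff matrix_matrix_mult_def sum_negf)

lemma matrix_scaleR_left: "(c *\<^sub>R (A::real^'n^'m)) ** B = c *\<^sub>R (A ** B)"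
  by (simp add: scalar_matrix_assoc)

lemma matrix_scaleR_right: "(A::real^'n^'m) ** (c *\<^sub>R B) = c *\<^sub>R (A ** B)"
  by (simp add: matrix_scalar_ac scalar_matrix_assoc)

lemma transpose_add: "transpose (A + B) = transpose A + transpose (B::'a::semiring_1^'n^'m)"
  by (simp add: vec_eq_iff transpose_def)

lemma transpose_diff: "transpose (A - B) = transpose A - transpose (B::'a::ring_1^'n^'m)"
  by (simp add: vec_eq_iff transpose_def)

lemma trace_scaleR: "trace (c *\<^sub>R (A::real^'n^'n)) = c * trace A"
  by (simp add: trace_def sum_distrib_left)

lemma trace_uminus: "trace (- (A::'a::comm_ring_1^'n^'n)) = - trace A"
  by (simp add: trace_def sum_negf)

lemma trace_transpose: "trace (transpose (A::'a::semiring_1^'n^'n)) = trace A"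
  by (simp add: trace_def transpose_def)

lemma matrix_vector_mult_uminus_right: "(A::real^'n^'m) *v (- x) = - (A *v x)"
  by (metis matrix_vector_mult_scaleR scaleR_minus1_left)

lemma inner_matrix_vector_transpose: "(v::real^'m) \<bullet> (A *v w) = (transpose A *v v) \<bullet> w"
  by (metis dot_lmul_matrix inner_commute transpose_matrix_vector)

lemma inner_axis_matrix_axis: "axis i 1 \<bullet> ((A::real^'n^'m) *v axis j 1) = A $ i $ j"
  by (simp add: inner_vec_def matrix_vector_mult_def axis_def if_distrib[of "\<lambda>x. _ * x"]
      if_distrib[of "\<lambda>x. x * _"] cong: if_cong)

definition quad_form :: "real^'m::finite \<Rightarrow> real^'m^'m \<Rightarrow> real" where
  "quad_form q A = q \<bullet> (A *v q)"

lemma quad_form_add: "quad_form q (A + B) = quad_form q A + quad_form q B"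
  and quad_form_diff: "quad_form q (A - B) = quad_form q A - quad_form q B"
  and quad_form_scaleR: "quad_form q (c *\<^sub>R A) = c * quad_form q A"
  by (simp_all add: quad_form_def matrix_vector_mult_add_rdistrib matrix_vector_mult_diff_rdistrib
      inner_add_right inner_diff_right scaleR_matrix_vector_assoc[symmetric])

lemma quad_form_uminus: "quad_form q (- A) = - quad_form q A"
  by (metis quad_form_scaleR scaleR_minus1_left mult_minus1)

lemma quad_form_transpose: "quad_form q (transpose A) = quad_form q A"
  by (simp add: quad_form_def inner_matrix_vector_transpose inner_commute)

lemma symmetric_entry_polarization:
  fixes P :: "real^'m::finite^'m"
  assumes "transpose P = P"
  shows "P $ i $ j = (quad_form (axis i 1 + axis j 1) P - quad_form (axis i 1) P - quad_form (axis j 1) P) / 2"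
proof -
  have "P $ j $ i = P $ i $ j" using assms by (metis transpose_def vec_lambda_beta)
  then show ?thesis
    by (simp add: quad_form_def matrix_vector_right_distrib inner_add_left inner_add_right
        inner_axis_matrix_axis)
qed

lemma symmetric_matrix_eqI:
  fixes P Q :: "real^'m::finite^'m"
  assumes "transpose P = P" "transpose Q = Q" "\<And>q. quad_form q P = quad_form q Q"
  shows "P = Q"
proof -
  have "P $ i $ j = Q $ i $ j" for i j
    using symmetric_entry_polarization[OF assms(1), of i j]
      symmetric_entry_polarization[OF assms(2), of i j] assms(3) by simp
  then show ?thesis by (simp add: vec_eq_iff)
qed

lemma matrix_inv_right: "invertible (A::real^'m::finite^'m) \<Longrightarrow> A ** matrix_inv A = mat 1"
  and matrix_inv_left: "invertible A \<Longrightarrow> matrix_inv A ** A = mat 1"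
  unfolding matrix_inv_def invertible_def by (metis (mono_tags, lifting) someI_ex)+

lemma matrix_inv_unique:
  fixes A B :: "real^'m::finite^'m"
  assumes "A ** B = mat 1"
  shows "matrix_inv A = B"
proof -
  have "B ** A = mat 1" using assms matrix_left_right_inverse by blast
  then have "invertible A" using assms invertible_def by blast
  then have "matrix_inv A = matrix_inv A ** (A ** B)" by (simp add: assms)
  also have "\<dots> = B" by (simp add: matrix_mul_assoc matrix_inv_left \<open>invertible A\<close>)
  finally show ?thesis .
qed

lemma invertible_matrix_inv: "invertible (A::real^'m::finite^'m) \<Longrightarrow> invertible (matrix_inv A)"
  and matrix_inv_matrix_inv: "invertible A \<Longrightarrow> matrix_inv (matrix_inv A) = A"
  using matrix_inv_left matrix_inv_right matrix_inv_unique unfolding invertible_def by blast+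

lemma matrix_inv_transpose:
  "invertible (A::real^'m::finite^'m) \<Longrightarrow> matrix_inv (transpose A) = transpose (matrix_inv A)"
  by (rule matrix_inv_unique) (metis matrix_inv_left matrix_transpose_mul transpose_mat)

lemma matrix_inv_cancel:
  fixes P C X :: "real^'m::finite^'m"
  assumes "P ** C = mat 1" "C ** P = mat 1"
  shows "P ** (C ** X ** C) ** P = X" "P ** (C ** X) = X" "X ** C ** P = X"
  using assms by (simp_all add: matrix_mul_assoc) (metis matrix_mul_assoc matrix_mul_lid matrix_mul_rid)+

section \<open>Block-diagonal and positive definite matrices\<close>

definition block_proj :: "'n::finite \<Rightarrow> real^('n \<times> 'd::finite)^('n \<times> 'd)" where
  "block_proj i = (\<chi> p r. if p = r \<and> fst p = i then 1 else 0)"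

lemma block_proj_mult_left: "(block_proj i ** A) $ p $ r = (if fst p = i then A $ p $ r else 0)"
  by (simp add: block_proj_def matrix_matrix_mult_def if_distrib[of "\<lambda>x. x * _"] cong: if_cong)

lemma block_proj_mult_right: "(A ** block_proj i) $ p $ r = (if fst r = i then A $ p $ r else 0)"
proof -
  have "(A ** block_proj i) $ p $ r = (\<Sum>k\<in>UNIV. if r = k then (if fst r = i then A $ p $ k else 0) else 0)"
    by (rule trans[OF _ sum.cong[OF refl]], simp add: block_proj_def matrix_matrix_mult_def, auto)
  then show ?thesis by simp
qed

text \<open>Block-diagonality is commutation with the projections onto the blocks; this makes
  closure under products and inverses immediate.\<close>

lemma block_diag_iff_commute:
  fixes A :: "real^('n::finite \<times> 'd::finite)^('n \<times> 'd)"
  shows "block_diag A \<longleftrightarrow> (\<forall>i. block_proj i ** A = A ** block_proj i)"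
proof
  assume "block_diag A"
  then show "\<forall>i. block_proj i ** A = A ** block_proj i"
    unfolding block_diag_def by (auto simp: vec_eq_iff block_proj_mult_left block_proj_mult_right)
next
  assume comm: "\<forall>i. block_proj i ** A = A ** block_proj i"
  show "block_diag A" unfolding block_diag_def
  proof (intro allI impI)
    fix i a j b assume "(i::'n) \<noteq> j"
    moreover have "(block_proj i ** A) $ (i,a) $ (j,b) = (A ** block_proj i) $ (i,a) $ (j,b)"
      using comm by simp
    ultimately show "A $ (i, a) $ (j, b) = 0" by (simp add: block_proj_mult_left block_proj_mult_right)
  qed
qed

lemma block_diag_mult:
  assumes "block_diag A" "block_diag B"
  shows "block_diag (A ** B)"
  using assms unfolding block_diag_iff_commute by (metis matrix_mul_assoc)

lemma block_diag_matrix_inv: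
  assumes "invertible A" "block_diag A"
  shows "block_diag (matrix_inv A)"
  unfolding block_diag_iff_commute
proof
  fix i
  let ?B = "matrix_inv A"
  have "block_proj i ** ?B = ?B ** (A ** block_proj i) ** ?B"
    by (simp add: matrix_mul_assoc matrix_inv_left[OF assms(1)])
  also have "\<dots> = ?B ** (block_proj i ** A) ** ?B"
    using assms(2) unfolding block_diag_iff_commute by simp
  also have "\<dots> = ?B ** block_proj i"
    by (simp add: matrix_mul_assoc[symmetric] matrix_inv_right[OF assms(1)])
  finally show "block_proj i ** ?B = ?B ** block_proj i" .
qed

lemma block_diag_add: "block_diag A \<Longrightarrow> block_diag B \<Longrightarrow> block_diag (A + B)"
  and block_diag_scaleR: "block_diag A \<Longrightarrow> block_diag (c *\<^sub>R A)"
  and block_diag_transpose: "block_diag A \<Longrightarrow> block_diag (transpose A)"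
  and block_diag_mat_one: "block_diag (mat 1)"
  by (auto simp: block_diag_def transpose_def mat_def)

lemma Ztilde_add: "A \<in> Ztilde \<Longrightarrow> B \<in> Ztilde \<Longrightarrow> A + B \<in> Ztilde"
  and Ztilde_diff: "A \<in> Ztilde \<Longrightarrow> B \<in> Ztilde \<Longrightarrow> A - B \<in> Ztilde"
  and Ztilde_scaleR: "A \<in> Ztilde \<Longrightarrow> c *\<^sub>R A \<in> Ztilde"
  and Ztilde_uminus: "A \<in> Ztilde \<Longrightarrow> - A \<in> Ztilde"
  and Ztilde_zero: "0 \<in> Ztilde"
  by (auto simp: Ztilde_def block_diag_def vec_eq_iff transpose_def)

lemma Ztilde_sum: "(\<And>a. a \<in> S \<Longrightarrow> X a \<in> Ztilde) \<Longrightarrow> (\<Sum>a\<in>S. X a) \<in> Ztilde"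
  by (induct S rule: infinite_finite_induct) (auto intro: Ztilde_add Ztilde_zero)

lemma Ztilde_sandwich: "S \<in> Ztilde \<Longrightarrow> X \<in> Ztilde \<Longrightarrow> S ** X ** S \<in> Ztilde"
  by (simp add: Ztilde_def block_diag_mult matrix_transpose_mul matrix_mul_assoc)

lemma pos_def_invertible:
  fixes A :: "real^'m::finite^'m"
  assumes "\<forall>v. v \<noteq> 0 \<longrightarrow> v \<bullet> (A *v v) > 0"
  shows "invertible A"
proof -
  have "\<forall>x. A *v x = 0 \<longrightarrow> x = 0" using assms by (metis inner_zero_right less_irrefl)
  then obtain B where "B ** A = mat 1" using matrix_left_invertible_ker by blast
  then show ?thesis using invertible_left_inverse by blast
qed

text \<open>The segment from the identity to a positive definite matrix stays positive definite,
  hence invertible, so by the intermediate value theorem its determinant cannot change sign.\<close>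

lemma pos_def_det_pos:
  fixes C :: "real^'m::finite^'m"
  assumes pd: "\<forall>v. v \<noteq> 0 \<longrightarrow> v \<bullet> (C *v v) > 0"
  shows "det C > 0"
proof (rule ccontr)
  assume "\<not> det C > 0"
  define M where "M t = (1 - t) *\<^sub>R mat 1 + t *\<^sub>R C" for t :: real
  have "isCont (\<lambda>t. det (M t)) t" for t
    unfolding det_def M_def by (simp add: mat_def) (intro continuous_intros)
  then have "\<exists>t\<ge>0. t \<le> 1 \<and> det (M t) = 0"
    using \<open>\<not> det C > 0\<close> by (intro IVT2) (auto simp: M_def)
  then obtain t where t: "0 \<le> t" "t \<le> 1" "det (M t) = 0" by blast
  have "v \<bullet> (M t *v v) > 0" if "v \<noteq> 0" for v
  proof -
    have "v \<bullet> (M t *v v) = (1 - t) * (v \<bullet> v) + t * (v \<bullet> (C *v v))"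
      by (simp add: M_def matrix_vector_mult_add_rdistrib scaleR_matrix_vector_assoc[symmetric]
          inner_add_right)
    moreover have "v \<bullet> v > 0" "v \<bullet> (C *v v) > 0" using that pd by auto
    ultimately show ?thesis using t
      by (cases "t = 0") (auto intro: add_nonneg_pos add_pos_nonneg)
  qed
  then have "invertible (M t)" by (intro pos_def_invertible) blast
  then show False using t(3) by (simp add: invertible_det_nz)
qed

lemma Zset_invertible: "C \<in> Zset \<Longrightarrow> invertible C"
  and Zset_det_pos: "C \<in> Zset \<Longrightarrow> det C > 0"
  by (simp_all add: Zset_def pos_def_invertible pos_def_det_pos)

lemma Zset_Ztilde: "C \<in> Zset \<Longrightarrow> C \<in> Ztilde"
  by (simp add: Zset_def Ztilde_def)

lemma Zset_matrix_inv_Ztilde: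
  assumes "C \<in> Zset"
  shows "matrix_inv C \<in> Ztilde"
proof -
  have "transpose (matrix_inv C) = matrix_inv C"
    using assms matrix_inv_transpose[OF Zset_invertible[OF assms]] by (simp add: Zset_def)
  then show ?thesis
    using assms by (simp add: Zset_def Ztilde_def block_diag_matrix_inv Zset_invertible)
qed

lemma Zset_matrix_inv:
  assumes "C \<in> Zset"
  shows "matrix_inv C ** C = mat 1" "C ** matrix_inv C = mat 1"
  using Zset_invertible[OF assms] by (simp_all add: matrix_inv_left matrix_inv_right)

lemma Zset_symmetric: "C \<in> Zset \<Longrightarrow> transpose C = C"
  and Zset_matrix_inv_symmetric: "C \<in> Zset \<Longrightarrow> transpose (matrix_inv C) = matrix_inv C"
  using Zset_Ztilde Zset_matrix_inv_Ztilde by (auto simp: Ztilde_def)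

section \<open>Derivatives of matrix-valued curves\<close>

definition has_matrix_derivative :: "(real \<Rightarrow> real^'n::finite^'m::finite) \<Rightarrow> real^'n^'m \<Rightarrow> real \<Rightarrow> bool"
  where "has_matrix_derivative c c' s \<longleftrightarrow>
    (\<forall>i j. ((\<lambda>r. c r $ i $ j) has_real_derivative c' $ i $ j) (at s))"

lemma has_matrix_derivative_const: "has_matrix_derivative (\<lambda>r. A) 0 s"
  by (simp add: has_matrix_derivative_def)

lemma has_matrix_derivative_add:
  "has_matrix_derivative a a' s \<Longrightarrow> has_matrix_derivative b b' s \<Longrightarrow>
    has_matrix_derivative (\<lambda>r. a r + b r) (a' + b') s"
  by (auto simp: has_matrix_derivative_def intro!: derivative_eq_intros)

lemma has_matrix_derivative_scaleR_left:
  "(f has_real_derivative f') (at s) \<Longrightarrow> has_matrix_derivative (\<lambda>r. f r *\<^sub>R A) (f' *\<^sub>R A) s"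
  by (auto simp: has_matrix_derivative_def intro!: derivative_eq_intros)

lemma has_matrix_derivative_transpose:
  "has_matrix_derivative a a' s \<Longrightarrow> has_matrix_derivative (\<lambda>r. transpose (a r)) (transpose a') s"
  by (auto simp: has_matrix_derivative_def transpose_def)

lemma has_matrix_derivative_mult:
  assumes "has_matrix_derivative a a' s" "has_matrix_derivative b b' s"
  shows "has_matrix_derivative (\<lambda>r. a r ** b r) (a' ** b s + a s ** b') s"
  unfolding has_matrix_derivative_def
proof (intro allI)
  fix i j
  have "((\<lambda>r. \<Sum>k\<in>UNIV. a r $ i $ k * b r $ k $ j) has_real_derivative
     (\<Sum>k\<in>UNIV. a s $ i $ k * b' $ k $ j + a' $ i $ k * b s $ k $ j)) (at s)"
    using assms unfolding has_matrix_derivative_def by (intro DERIV_sum DERIV_mult') auto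
  then show "((\<lambda>r. (a r ** b r) $ i $ j) has_real_derivative (a' ** b s + a s ** b') $ i $ j) (at s)"
    by (simp add: matrix_matrix_mult_def sum.distrib add.commute)
qed

lemma has_matrix_derivative_cong_ev:
  assumes "eventually (\<lambda>r. c r = d r) (nhds s)" "has_matrix_derivative c c' s"
  shows "has_matrix_derivative d c' s"
  unfolding has_matrix_derivative_def
proof (intro allI)
  fix i j
  have ev: "eventually (\<lambda>r. c r $ i $ j = d r $ i $ j) (nhds s)"
    using assms(1) by (rule eventually_mono) simp
  show "((\<lambda>r. d r $ i $ j) has_real_derivative c' $ i $ j) (at s)"
    using assms(2) DERIV_cong_ev[OF refl ev refl] unfolding has_matrix_derivative_def by blast
qed

lemma has_matrix_derivative_unique:
  "has_matrix_derivative c a s \<Longrightarrow> has_matrix_derivative c b s \<Longrightarrow> a = b"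
  unfolding has_matrix_derivative_def vec_eq_iff using DERIV_unique by blast

lemma has_matrix_derivative_entrywise:
  assumes "\<And>i j. (\<lambda>r. c r $ i $ j) differentiable (at s)"
  shows "has_matrix_derivative c (\<chi> i j. deriv (\<lambda>r. c r $ i $ j) s) s"
  using assms by (simp add: has_matrix_derivative_def DERIV_deriv_iff_real_differentiable)

lemma has_matrix_derivative_Ztilde:
  assumes "\<And>r. c r \<in> Ztilde" "has_matrix_derivative c c' s"
  shows "c' \<in> Ztilde"
proof -
  have D: "((\<lambda>r. c r $ p $ p') has_real_derivative c' $ p $ p') (at s)" for p p'
    using assms(2) unfolding has_matrix_derivative_def by blast
  have "c' $ (i,a) $ (j,b) = 0" if "i \<noteq> j" for i a j b
  proof -
    have "c r $ (i,a) $ (j,b) = 0" for r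
      using assms(1)[of r] that unfolding Ztilde_def block_diag_def by blast
    then have "((\<lambda>r. 0) has_real_derivative c' $ (i,a) $ (j,b)) (at s)"
      using D[of "(i,a)" "(j,b)"] by simp
    then show ?thesis using DERIV_const DERIV_unique by blast
  qed
  then have "block_diag c'" unfolding block_diag_def by blast
  moreover have "c' $ p' $ p = c' $ p $ p'" for p p'
  proof -
    have "c r $ p' $ p = c r $ p $ p'" for r
    proof -
      have "transpose (c r) $ p $ p' = c r $ p $ p'" using assms(1)[of r] by (simp add: Ztilde_def)
      then show ?thesis by (simp add: transpose_def)
    qed
    then have "((\<lambda>r. c r $ p $ p') has_real_derivative c' $ p' $ p) (at s)"
      using D[of p' p] by simp
    then show ?thesis using D[of p p'] DERIV_unique by blast
  qed
  then have "transpose c' = c'" by (simp add: vec_eq_iff transpose_def)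
  ultimately show ?thesis by (simp add: Ztilde_def)
qed

lemma has_real_derivative_quad_form:
  assumes "has_matrix_derivative c c' s"
  shows "((\<lambda>r. quad_form q (c r)) has_real_derivative quad_form q c') (at s)"
proof -
  have "((\<lambda>r. \<Sum>i\<in>UNIV. q$i * (\<Sum>j\<in>UNIV. c r$i$j * q$j)) has_real_derivative
          (\<Sum>i\<in>UNIV. q$i * (\<Sum>j\<in>UNIV. c'$i$j * q$j))) (at s)"
    using assms unfolding has_matrix_derivative_def
    by (intro DERIV_sum DERIV_cmult DERIV_cmult_right) auto
  then show ?thesis
    by (simp add: quad_form_def inner_vec_def matrix_vector_mult_def mult.commute)
qed

lemma has_real_derivative_trace:
  "has_matrix_derivative c c' s \<Longrightarrow> ((\<lambda>r. trace (c r)) has_real_derivative trace c') (at s)"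
  unfolding has_matrix_derivative_def trace_def by (intro DERIV_sum) auto

subsection \<open>Jacobi's formula\<close>

definition det_deriv :: "real^'m::finite^'m \<Rightarrow> real^'m^'m \<Rightarrow> real" where
  "det_deriv A X = (\<Sum>p\<in>{p. p permutes (UNIV::'m set)}. of_int (sign p) *
      (\<Sum>k\<in>UNIV. X $ k $ p k * (\<Prod>i\<in>UNIV - {k}. A $ i $ p i)))"

lemma has_real_derivative_det_deriv:
  fixes c :: "real \<Rightarrow> real^'m::finite^'m"
  shows "has_matrix_derivative c c' s \<Longrightarrow> ((\<lambda>r. det (c r)) has_real_derivative det_deriv (c s) c') (at s)"
  unfolding has_matrix_derivative_def det_def det_deriv_def
  by (intro DERIV_sum DERIV_cmult has_field_derivative_prod) auto

lemma det_deriv_row_sum: "det_deriv A X = (\<Sum>k\<in>UNIV. det (\<chi> i. if i = k then X $ k else A $ i))"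
proof -
  have "(\<Prod>i\<in>UNIV. (\<chi> i. if i = k then X $ k else A $ i) $ i $ p i) =
      X $ k $ p k * (\<Prod>i\<in>UNIV - {k}. A $ i $ p i)" for k p
  proof -
    have "(\<Prod>i\<in>UNIV. (\<chi> i. if i = k then X $ k else A $ i) $ i $ p i) =
        (\<chi> i. if i = k then X $ k else A $ i) $ k $ p k *
        (\<Prod>i\<in>UNIV - {k}. (\<chi> i. if i = k then X $ k else A $ i) $ i $ p i)"
      by (rule prod.remove) auto
    also have "(\<Prod>i\<in>UNIV - {k}. (\<chi> i. if i = k then X $ k else A $ i) $ i $ p i) =
        (\<Prod>i\<in>UNIV - {k}. A $ i $ p i)"
      by (rule prod.cong) auto
    finally show ?thesis by simp
  qed
  then show ?thesis
    unfolding det_deriv_def det_def by (simp add: sum_distrib_left) (rule sum.swap)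
qed

text \<open>Writing \<open>X = Y A\<close>, the \<open>k\<close>-th row-replacement determinant is \<open>Y\<^sub>k\<^sub>k det A\<close> by
  Cramer's lemma.\<close>

lemma det_deriv_eq_trace:
  fixes A X :: "real^'m::finite^'m"
  assumes "invertible A"
  shows "det_deriv A X = det A * trace (matrix_inv A ** X)"
proof -
  define Y where "Y = X ** matrix_inv A"
  have XY: "Y ** A = X"
    unfolding Y_def by (simp add: matrix_mul_assoc[symmetric] matrix_inv_left[OF assms])
  have "det (\<chi> i. if i = k then X $ k else A $ i) = Y $ k $ k * det A" for k
  proof -
    have "X $ k = (\<Sum>m\<in>UNIV. row k Y $ m *s row m A)"
      unfolding XY[symmetric] by (simp add: vec_eq_iff matrix_matrix_mult_def row_def)
    moreover have "A $ i = row i A" for i by (simp add: row_def vec_lambda_eta)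
    ultimately have "(\<chi> i. if i = k then X $ k else A $ i) =
        (\<chi> i. if i = k then (\<Sum>m\<in>UNIV. row k Y $ m *s row m A) else row i A)"
      by (simp only:)
    then show ?thesis using cramer_lemma_transpose[of k "row k Y" A] by (simp add: row_def)
  qed
  then have "det_deriv A X = det A * trace Y"
    unfolding det_deriv_row_sum trace_def by (simp add: sum_distrib_left mult.commute)
  then show ?thesis using trace_mul_sym[of X "matrix_inv A"] by (simp add: Y_def)
qed

lemma has_real_derivative_det:
  fixes c :: "real \<Rightarrow> real^'m::finite^'m"
  assumes "has_matrix_derivative c c' s" "invertible (c s)"
  shows "((\<lambda>r. det (c r)) has_real_derivative det (c s) * trace (matrix_inv (c s) ** c')) (at s)"
  using has_real_derivative_det_deriv[OF assms(1)] det_deriv_eq_trace[OF assms(2)] by simp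

lemma eventually_invertible:
  fixes c :: "real \<Rightarrow> real^'m::finite^'m"
  assumes "has_matrix_derivative c c' s" "invertible (c s)"
  shows "eventually (\<lambda>r. invertible (c r)) (nhds s)"
proof -
  have "isCont (\<lambda>r. det (c r)) s"
    using has_real_derivative_det_deriv[OF assms(1)] by (rule DERIV_isCont)
  then have "((\<lambda>r. det (c r)) \<longlongrightarrow> det (c s)) (at s)" by (simp add: isCont_def)
  moreover have nz: "det (c s) \<noteq> 0" using assms(2) invertible_det_nz by blast
  ultimately have "eventually (\<lambda>r. det (c r) \<noteq> 0) (at s)"
    using tendsto_imp_eventually_ne by blast
  then have "eventually (\<lambda>r. det (c r) \<noteq> 0) (nhds s)"
    using nz eventually_nhds_conv_at by blast
  then show ?thesis by (rule eventually_mono) (simp add: invertible_det_nz)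
qed

lemma matrix_inv_entry_cramer:
  fixes A :: "real^'m::finite^'m"
  assumes "invertible A"
  shows "matrix_inv A $ k $ j = det (\<chi> i l. if l = k then (if i = j then 1 else 0) else A $ i $ l) / det A"
proof -
  have "A *v (matrix_inv A *v axis j 1) = axis j 1"
    by (simp add: matrix_vector_mul_assoc matrix_inv_right[OF assms])
  then have "matrix_inv A *v axis j 1 = (\<chi> k. det (\<chi> i l. if l = k then axis j 1 $ i else A $ i $ l) / det A)"
    using cramer assms invertible_det_nz by blast
  moreover have "(matrix_inv A *v axis j 1) $ k = matrix_inv A $ k $ j"
    by (simp add: matrix_vector_mult_def axis_def if_distrib[of "\<lambda>x. _ * x"] cong: if_cong)
  moreover have "(\<chi> i l. if l = k then axis j 1 $ i else A $ i $ l) =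
      (\<chi> i l. if l = k then (if i = j then 1 else 0) else A $ i $ l)"
    by (simp add: vec_eq_iff axis_def)
  ultimately show ?thesis by simp
qed

lemma matrix_inv_entry_differentiable:
  fixes c :: "real \<Rightarrow> real^'m::finite^'m"
  assumes "has_matrix_derivative c c' s" "invertible (c s)"
  shows "(\<lambda>r. matrix_inv (c r) $ k $ j) differentiable (at s)"
proof -
  define c\<^sub>k where "c\<^sub>k r = (\<chi> i l. if l = k then (if i = j then 1 else 0) else c r $ i $ l)" for r
  have "has_matrix_derivative c\<^sub>k (\<chi> i l. if l = k then 0 else c' $ i $ l) s"
    using assms(1) unfolding has_matrix_derivative_def c\<^sub>k_def by auto
  from DERIV_divide[OF has_real_derivative_det_deriv[OF this] has_real_derivative_det_deriv[OF assms(1)]]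
  have "(\<lambda>r. det (c\<^sub>k r) / det (c r)) differentiable (at s)"
    using assms(2) invertible_det_nz real_differentiable_def by blast
  moreover have "eventually (\<lambda>r. det (c\<^sub>k r) / det (c r) = matrix_inv (c r) $ k $ j) (nhds s)"
    using eventually_invertible[OF assms]
    by (rule eventually_mono) (simp add: matrix_inv_entry_cramer c\<^sub>k_def)
  ultimately show ?thesis
    unfolding real_differentiable_def using DERIV_cong_ev[OF refl _ refl] by metis
qed

text \<open>Once the entries of \<open>c\<^sup>-\<^sup>1\<close> are known to be differentiable, the formula follows by
  differentiating \<open>c c\<^sup>-\<^sup>1 = 1\<close>.\<close>

lemma has_matrix_derivative_matrix_inv:
  fixes c :: "real \<Rightarrow> real^'m::finite^'m"
  assumes "has_matrix_derivative c c' s" "invertible (c s)"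
  shows "has_matrix_derivative (\<lambda>r. matrix_inv (c r)) (- (matrix_inv (c s) ** c' ** matrix_inv (c s))) s"
proof -
  let ?P = "matrix_inv (c s)"
  obtain P' where P': "has_matrix_derivative (\<lambda>r. matrix_inv (c r)) P' s"
    using has_matrix_derivative_entrywise[OF matrix_inv_entry_differentiable[OF assms]] by blast
  have "has_matrix_derivative (\<lambda>r. c r ** matrix_inv (c r)) (c' ** ?P + c s ** P') s"
    by (rule has_matrix_derivative_mult[OF assms(1) P'])
  moreover have "has_matrix_derivative (\<lambda>r. c r ** matrix_inv (c r)) 0 s"
    using eventually_invertible[OF assms]
    by (intro has_matrix_derivative_cong_ev[OF _ has_matrix_derivative_const[of "mat 1"]])
      (simp add: eventually_mono matrix_inv_right)
  ultimately have "c' ** ?P + c s ** P' = 0" by (rule has_matrix_derivative_unique)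
  then have "c s ** P' = - (c' ** ?P)" by (simp add: eq_neg_iff_add_eq_0 add.commute)
  then have "?P ** (c s ** P') = - (?P ** c' ** ?P)"
    by (simp add: matrix_uminus_right matrix_mul_assoc)
  then show ?thesis using P' by (simp add: matrix_mul_assoc matrix_inv_left[OF assms(2)])
qed

section \<open>The Gaussian \<open>\<Phi>\<close> along curves of covariance matrices\<close>

text \<open>\<open>log_Phi_deriv C X q\<close> is the derivative of \<open>log \<Phi>(C, q)\<close> in the direction \<open>X\<close>; it equals
  \<open>q\<^sup>T A q - tr (A C)\<close> for the tangent matrix \<open>A = C\<^sup>-\<^sup>1 X C\<^sup>-\<^sup>1 / 2\<close>, which is how velocities of
  covariance matrices parametrise tangent vectors of \<open>\<M>\<^sub>\<Phi>\<close>.\<close>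

definition log_Phi_deriv :: "real^'m::finite^'m \<Rightarrow> real^'m^'m \<Rightarrow> real^'m \<Rightarrow> real" where
  "log_Phi_deriv C X q =
    (quad_form q (matrix_inv C ** X ** matrix_inv C) - trace (matrix_inv C ** X)) / 2"

definition tangent_matrix :: "real^'m::finite^'m \<Rightarrow> real^'m^'m \<Rightarrow> real^'m^'m" where
  "tangent_matrix C X = (1/2) *\<^sub>R (matrix_inv C ** X ** matrix_inv C)"

lemma log_Phi_deriv_add: "log_Phi_deriv C (X + Y) q = log_Phi_deriv C X q + log_Phi_deriv C Y q"
  and log_Phi_deriv_diff: "log_Phi_deriv C (X - Y) q = log_Phi_deriv C X q - log_Phi_deriv C Y q"
  and log_Phi_deriv_scaleR: "log_Phi_deriv C (c *\<^sub>R X) q = c * log_Phi_deriv C X q"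
  by (simp_all add: log_Phi_deriv_def matrix_add_ldistrib matrix_add_rdistrib matrix_diff_ldistrib
      matrix_diff_rdistrib matrix_scaleR_left matrix_scaleR_right quad_form_add quad_form_diff
      quad_form_scaleR trace_add trace_sub trace_scaleR algebra_simps diff_divide_distrib
      add_divide_distrib)

lemma log_Phi_deriv_sum: "log_Phi_deriv C (\<Sum>a\<in>S. X a) q = (\<Sum>a\<in>S. log_Phi_deriv C (X a) q)"
  by (induct S rule: infinite_finite_induct)
    (simp_all add: log_Phi_deriv_add, simp_all add: log_Phi_deriv_def quad_form_def trace_def)

lemma tangent_matrix_factor:
  assumes "C \<in> Zset"
  shows "q \<bullet> (tangent_matrix C X *v q) - trace (tangent_matrix C X ** C) = log_Phi_deriv C X q"
proof -
  have "matrix_inv C ** X ** matrix_inv C ** C = matrix_inv C ** X"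
    using Zset_matrix_inv[OF assms] by (simp add: matrix_mul_assoc[symmetric])
  then show ?thesis
    by (simp add: tangent_matrix_def log_Phi_deriv_def matrix_scaleR_left trace_scaleR
        quad_form_def[symmetric] quad_form_scaleR diff_divide_distrib)
qed

lemma tangent_matrix_Ztilde: "C \<in> Zset \<Longrightarrow> X \<in> Ztilde \<Longrightarrow> tangent_matrix C X \<in> Ztilde"
  unfolding tangent_matrix_def
  by (intro Ztilde_scaleR Ztilde_sandwich Zset_matrix_inv_Ztilde)

lemma tangent_matrix_sandwich: "C \<in> Zset \<Longrightarrow> tangent_matrix C (2 *\<^sub>R (C ** A ** C)) = A"
  using matrix_inv_cancel(1)[OF Zset_matrix_inv[of C]]
  by (simp add: tangent_matrix_def matrix_scaleR_left matrix_scaleR_right)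

lemma Phi_eq: "Phi C q = exp (- quad_form q (matrix_inv C) / 2) / sqrt ((2 * pi) ^ CARD('n \<times> 'd) * det C)"
  for C :: "real^('n::finite \<times> 'd::finite)^('n \<times> 'd)"
  by (simp add: Phi_def quad_form_def)

lemma Phi_pos: "det C > 0 \<Longrightarrow> Phi C q > 0"
  by (simp add: Phi_def)

lemma Phi_ratio:
  "det C > 0 \<Longrightarrow> Phi C q / Phi C 0 = exp (- quad_form q (matrix_inv C) / 2)"
  by (simp add: Phi_eq quad_form_def)

lemma Phi_inject:
  assumes "C \<in> Zset" "C' \<in> Zset" "\<And>q. Phi C q = Phi C' q"
  shows "C = C'"
proof -
  have "quad_form q (matrix_inv C) = quad_form q (matrix_inv C')" for q
    using Phi_ratio[OF Zset_det_pos[OF assms(1)], of q] Phi_ratio[OF Zset_det_pos[OF assms(2)], of q]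
      assms(3) by simp
  then have "matrix_inv C = matrix_inv C'"
    using symmetric_matrix_eqI Zset_matrix_inv_symmetric assms(1,2) by blast
  then show ?thesis
    by (metis assms(1,2) Zset_invertible matrix_inv_matrix_inv)
qed

lemma has_real_derivative_Phi:
  fixes c :: "real \<Rightarrow> real^('n::finite \<times> 'd::finite)^('n \<times> 'd)"
  assumes c': "has_matrix_derivative c c' s" and Z: "c s \<in> Zset"
  shows "((\<lambda>r. Phi (c r) q) has_real_derivative log_Phi_deriv (c s) c' q * Phi (c s) q) (at s)"
proof -
  let ?K = "(2 * pi) ^ CARD('n \<times> 'd) :: real"
  let ?P = "matrix_inv (c s)"
  define E where "E = exp (- quad_form q ?P / 2)"
  define S where "S = sqrt (?K * det (c s))"
  have pos: "?K * det (c s) > 0" using Zset_det_pos[OF Z] by simp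
  then have S: "S > 0" "S * S = ?K * det (c s)" by (simp_all add: S_def)
  have dE: "((\<lambda>r. exp (- quad_form q (matrix_inv (c r)) / 2)) has_real_derivative
      E * (quad_form q (?P ** c' ** ?P) / 2)) (at s)"
    using has_real_derivative_quad_form[OF has_matrix_derivative_matrix_inv[OF c' Zset_invertible[OF Z]]]
    by (auto intro!: derivative_eq_intros simp: quad_form_uminus E_def)
  have dS: "((\<lambda>r. sqrt (?K * det (c r))) has_real_derivative
      inverse S / 2 * (?K * (det (c s) * trace (?P ** c')))) (at s)"
    unfolding S_def by (rule DERIV_chain2[OF DERIV_real_sqrt[OF pos]
          DERIV_cmult[OF has_real_derivative_det[OF c' Zset_invertible[OF Z]]]])
  have "sqrt (?K * det (c s)) \<noteq> 0" using S(1) unfolding S_def by linarith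
  from DERIV_divide[OF dE dS this, folded E_def S_def]
  have "((\<lambda>r. Phi (c r) q) has_real_derivative
      (E * (quad_form q (?P ** c' ** ?P) / 2) * S
        - E * (inverse S / 2 * (?K * (det (c s) * trace (?P ** c'))))) / (S * S)) (at s)"
    unfolding Phi_eq .
  moreover have "(E * (quad_form q (?P ** c' ** ?P) / 2) * S
        - E * (inverse S / 2 * (?K * (det (c s) * trace (?P ** c'))))) / (S * S)
      = log_Phi_deriv (c s) c' q * Phi (c s) q"
  proof -
    have "?K * (det (c s) * trace (?P ** c')) = S * S * trace (?P ** c')"
      by (metis S(2) mult.assoc)
    moreover have "Phi (c s) q = E / S" by (simp add: Phi_eq E_def S_def)
    ultimately show ?thesis
      using S(1) by (simp only:) (simp add: log_Phi_deriv_def field_simps)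
  qed
  ultimately show ?thesis by simp
qed

lemma Phi_curve_matrix_inv_differentiable:
  fixes \<gamma> :: "real \<Rightarrow> real^('n::finite \<times> 'd::finite)^('n \<times> 'd)"
  assumes Z: "\<And>s. \<gamma> s \<in> Zset" and D: "\<And>q. (\<lambda>s. Phi (\<gamma> s) q) differentiable (at 0)"
  obtains P' where "has_matrix_derivative (\<lambda>s. matrix_inv (\<gamma> s)) P' 0"
proof -
  have quad: "(\<lambda>s. quad_form q (matrix_inv (\<gamma> s))) differentiable (at 0)" for q
  proof -
    have pos: "Phi (\<gamma> 0) q / Phi (\<gamma> 0) 0 > 0"
      by (simp add: Phi_pos Zset_det_pos Z)
    have "(\<lambda>s. Phi (\<gamma> s) q / Phi (\<gamma> s) 0) differentiable (at 0)"
      using D Phi_pos[OF Zset_det_pos[OF Z]] by (intro differentiable_divide) (auto simp: less_imp_neq[symmetric])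
    then obtain E where E: "((\<lambda>s. Phi (\<gamma> s) q / Phi (\<gamma> s) 0) has_real_derivative E) (at 0)"
      by (auto simp: real_differentiable_def)
    have "(\<lambda>s. -2 * ln (Phi (\<gamma> s) q / Phi (\<gamma> s) 0)) differentiable (at 0)"
      unfolding real_differentiable_def using DERIV_cmult[OF DERIV_chain2[OF DERIV_ln[OF pos] E]] by blast
    moreover have "-2 * ln (Phi (\<gamma> s) q / Phi (\<gamma> s) 0) = quad_form q (matrix_inv (\<gamma> s))" for s
      using Phi_ratio[OF Zset_det_pos[OF Z]] by simp
    ultimately show ?thesis by simp
  qed
  have "(\<lambda>s. matrix_inv (\<gamma> s) $ i $ j) differentiable (at 0)" for i j
  proof -
    let ?a = "axis i 1" and ?b = "axis j 1"
    have "matrix_inv (\<gamma> s) $ i $ j = (quad_form (?a + ?b) (matrix_inv (\<gamma> s))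
        - quad_form ?a (matrix_inv (\<gamma> s)) - quad_form ?b (matrix_inv (\<gamma> s))) / 2" for s
      using symmetric_entry_polarization[OF Zset_matrix_inv_symmetric[OF Z]] .
    then show ?thesis
      using quad by (simp only:) (intro differentiable_divide differentiable_diff, auto)
  qed
  then show thesis by (rule that[OF has_matrix_derivative_entrywise])
qed

lemma Phi_curve_velocity:
  fixes \<gamma> :: "real \<Rightarrow> real^('n::finite \<times> 'd::finite)^('n \<times> 'd)"
  assumes Z: "\<And>s. \<gamma> s \<in> Zset" and D: "\<And>q. ((\<lambda>s. Phi (\<gamma> s) q) has_real_derivative \<phi> q) (at 0)"
  shows "\<exists>A\<in>Ztilde. \<forall>q. \<phi> q = (q \<bullet> (A *v q) - trace (A ** \<gamma> 0)) * Phi (\<gamma> 0) q"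
proof -
  let ?C = "\<gamma> 0"
  have "(\<lambda>s. Phi (\<gamma> s) q) differentiable (at 0)" for q
    using D real_differentiable_def by blast
  then obtain P' where P': "has_matrix_derivative (\<lambda>s. matrix_inv (\<gamma> s)) P' 0"
    by (rule Phi_curve_matrix_inv_differentiable[of \<gamma>, OF Z])
  have "P' \<in> Ztilde" using has_matrix_derivative_Ztilde[OF Zset_matrix_inv_Ztilde[OF Z] P'] .
  then have Z': "- (?C ** P' ** ?C) \<in> Ztilde"
    using Ztilde_uminus Ztilde_sandwich Zset_Ztilde Z by blast
  have "has_matrix_derivative (\<lambda>s. matrix_inv (matrix_inv (\<gamma> s))) (- (?C ** P' ** ?C)) 0"
    using has_matrix_derivative_matrix_inv[OF P' invertible_matrix_inv[OF Zset_invertible[OF Z]]]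
    by (simp add: matrix_inv_matrix_inv Zset_invertible Z)
  then have "has_matrix_derivative \<gamma> (- (?C ** P' ** ?C)) 0"
    by (simp add: matrix_inv_matrix_inv Zset_invertible Z)
  then have "\<phi> q = log_Phi_deriv ?C (- (?C ** P' ** ?C)) q * Phi ?C q" for q
    using DERIV_unique[OF D has_real_derivative_Phi[OF _ Z]] by blast
  then show ?thesis
    using tangent_matrix_factor[OF Z] tangent_matrix_Ztilde[OF Z Z'] by metis
qed

lemma Zset_congruence:
  assumes "C \<in> Zset" "invertible Y" "block_diag Y"
  shows "Y ** C ** transpose Y \<in> Zset"
proof -
  have "v \<bullet> ((Y ** C ** transpose Y) *v v) > 0" if "v \<noteq> 0" for v
  proof -
    have "transpose Y *v v \<noteq> 0"
      using that assms(2) transpose_invertible invertible_def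
      by (metis matrix_vector_mul_assoc matrix_vector_mul_lid matrix_vector_mult_0_right)
    then have "(transpose Y *v v) \<bullet> (C *v (transpose Y *v v)) > 0"
      using assms(1) by (simp add: Zset_def)
    then show ?thesis
      by (simp add: inner_matrix_vector_transpose matrix_vector_mul_assoc[symmetric])
  qed
  then show ?thesis
    using assms(1,3) by (simp add: Zset_def block_diag_mult block_diag_transpose
        matrix_transpose_mul matrix_mul_assoc)
qed

text \<open>The congruence \<open>Y C Y\<^sup>T\<close> with \<open>Y = 1 + s C A\<close> has velocity \<open>2 C A C\<close> at \<open>s = 0\<close> and
  is positive definite whenever \<open>Y\<close> is invertible; the fallback value \<open>C\<close> for singular \<open>Y\<close> only
  keeps the curve inside the covariance matrices and does not matter near \<open>s = 0\<close>.\<close>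

definition spd_curve :: "real^'m::finite^'m \<Rightarrow> real^'m^'m \<Rightarrow> real \<Rightarrow> real^'m^'m" where
  "spd_curve C A s =
    (let Y = mat 1 + s *\<^sub>R (C ** A) in if invertible Y then Y ** C ** transpose Y else C)"

lemma invertible_mat_one: "invertible (mat 1 :: real^'m::finite^'m)"
  unfolding invertible_def by auto

lemma spd_curve_zero: "spd_curve C A 0 = C"
  by (simp add: spd_curve_def invertible_mat_one)

lemma spd_curve_Zset:
  assumes "C \<in> Zset" "A \<in> Ztilde"
  shows "spd_curve C A s \<in> Zset"
proof -
  have "block_diag (mat 1 + s *\<^sub>R (C ** A))"
    using assms by (simp add: Zset_def Ztilde_def block_diag_add block_diag_scaleR block_diag_mult
        block_diag_mat_one)
  then show ?thesis
    using assms(1) by (auto simp: spd_curve_def Let_def intro: Zset_congruence)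
qed

lemma has_matrix_derivative_spd_curve:
  assumes "C \<in> Zset" "A \<in> Ztilde"
  shows "has_matrix_derivative (spd_curve C A) (2 *\<^sub>R (C ** A ** C)) 0"
proof -
  define Y where "Y s = mat 1 + s *\<^sub>R (C ** A)" for s
  have "has_matrix_derivative Y (0 + 1 *\<^sub>R (C ** A)) 0"
    unfolding Y_def
    by (intro has_matrix_derivative_add has_matrix_derivative_const
        has_matrix_derivative_scaleR_left DERIV_ident)
  then have Y': "has_matrix_derivative Y (C ** A) 0" by simp
  have "eventually (\<lambda>s. invertible (Y s)) (nhds 0)"
    by (rule eventually_invertible[OF Y']) (simp add: Y_def invertible_mat_one)
  then have "eventually (\<lambda>s. Y s ** C ** transpose (Y s) = spd_curve C A s) (nhds 0)"
    by (rule eventually_mono) (simp add: spd_curve_def Y_def Let_def)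
  moreover have "has_matrix_derivative (\<lambda>s. Y s ** C ** transpose (Y s))
      ((C ** A ** C + Y 0 ** 0) ** transpose (Y 0) + (Y 0 ** C) ** transpose (C ** A)) 0"
    by (intro has_matrix_derivative_mult has_matrix_derivative_transpose Y' has_matrix_derivative_const)
  moreover have "transpose (C ** A) = A ** C"
    using assms by (simp add: matrix_transpose_mul Zset_symmetric Ztilde_def)
  ultimately show ?thesis
    by (simp add: has_matrix_derivative_cong_ev Y_def matrix_mul_assoc scaleR_2)
qed

lemma Phi_spd_curve_velocity:
  assumes "C \<in> Zset" "A \<in> Ztilde"
  shows "((\<lambda>s. Phi (spd_curve C A s) q) has_real_derivative
           (q \<bullet> (A *v q) - trace (A ** C)) * Phi C q) (at 0)"
  using has_real_derivative_Phi[OF has_matrix_derivative_spd_curve[OF assms], of q] assms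
  by (simp add: spd_curve_zero spd_curve_Zset tangent_matrix_factor[symmetric] tangent_matrix_sandwich)

section \<open>The tangent space of \<open>\<M>\<^sub>\<Phi>\<close>\<close>

lemma tangent_spaceD:
  fixes C :: "real^'d::finite \<Rightarrow> real^('n::finite \<times> 'd)^('n \<times> 'd)"
  assumes C: "\<forall>x\<in>\<Omega>. C x \<in> Zset" and f: "\<forall>x\<in>\<Omega>. \<forall>q. f (x,q) = Phi (C x) q"
    and \<phi>: "\<phi> \<in> tangent_space \<Omega> f"
  shows "\<exists>A. (\<forall>x\<in>\<Omega>. A x \<in> Ztilde) \<and>
    (\<forall>x\<in>\<Omega>. \<forall>q. \<phi> (x,q) = (q \<bullet> (A x *v q) - trace (A x ** C x)) * f (x,q))"
proof -
  obtain \<gamma> :: "real \<Rightarrow> real^'d \<Rightarrow> real^('n \<times> 'd)^('n \<times> 'd)" where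
    Z: "\<forall>s. \<forall>x\<in>\<Omega>. \<gamma> s x \<in> Zset" and \<gamma>0: "\<forall>x\<in>\<Omega>. \<forall>q. Phi (\<gamma> 0 x) q = f (x,q)"
    and D: "\<forall>x\<in>\<Omega>. \<forall>q. ((\<lambda>s. Phi (\<gamma> s x) q) has_real_derivative \<phi> (x,q)) (at 0)"
    using \<phi> unfolding tangent_space_def by blast
  have "\<exists>A\<in>Ztilde. \<forall>q. \<phi> (x,q) = (q \<bullet> (A *v q) - trace (A ** C x)) * f (x,q)" if x: "x \<in> \<Omega>" for x
  proof -
    have "\<gamma> 0 x = C x" by (rule Phi_inject) (use Z \<gamma>0 C f x in auto)
    then show ?thesis
      using Phi_curve_velocity[of "\<lambda>s. \<gamma> s x" "\<lambda>q. \<phi> (x,q)"] Z D f x by auto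
  qed
  then show ?thesis by (metis (no_types, lifting) bchoice)
qed

lemma tangent_spaceI:
  fixes C :: "real^'d::finite \<Rightarrow> real^('n::finite \<times> 'd)^('n \<times> 'd)"
  assumes C: "\<forall>x\<in>\<Omega>. C x \<in> Zset" and f: "\<forall>x\<in>\<Omega>. \<forall>q. f (x,q) = Phi (C x) q"
    and H: "\<phi> \<in> Hspace \<Omega>" and A: "\<forall>x\<in>\<Omega>. A x \<in> Ztilde"
    and \<phi>: "\<forall>x\<in>\<Omega>. \<forall>q. \<phi> (x,q) = (q \<bullet> (A x *v q) - trace (A x ** C x)) * f (x,q)"
  shows "\<phi> \<in> tangent_space \<Omega> f"
proof -
  have "\<forall>s. \<forall>x\<in>\<Omega>. spd_curve (C x) (A x) s \<in> Zset"
    using C A spd_curve_Zset by blast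
  moreover have "\<forall>x\<in>\<Omega>. \<forall>q. Phi (spd_curve (C x) (A x) 0) q = f (x,q)"
    using f by (simp add: spd_curve_zero)
  moreover have "((\<lambda>s. Phi (spd_curve (C x) (A x) s) q) has_real_derivative \<phi> (x,q)) (at 0)"
    if "x \<in> \<Omega>" for x q
    using Phi_spd_curve_velocity[of "C x" "A x" q] C A \<phi> f that by simp
  ultimately show ?thesis
    using H unfolding tangent_space_def
    by (intro CollectI conjI exI[of _ "\<lambda>s x. spd_curve (C x) (A x) s"]) auto
qed

lemma tangent_space_eq:
  fixes C :: "real^'d::finite \<Rightarrow> real^('n::finite \<times> 'd)^('n \<times> 'd)"
  assumes "\<forall>x\<in>\<Omega>. C x \<in> Zset" "\<forall>x\<in>\<Omega>. \<forall>q. f (x,q) = Phi (C x) q"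
  shows "tangent_space \<Omega> f = {\<phi> \<in> Hspace \<Omega>. \<exists>A. (\<forall>x\<in>\<Omega>. A x \<in> Ztilde) \<and>
    (\<forall>x\<in>\<Omega>. \<forall>q. \<phi> (x,q) = (q \<bullet> (A x *v q) - trace (A x ** C x)) * f (x,q))}"
  using tangent_spaceD[OF assms] tangent_spaceI[OF assms]
  by (auto simp: tangent_space_def)

section \<open>The configurational operator\<close>

lemma pd_eqI: "((\<lambda>s. g (y + s *\<^sub>R axis k 1)) has_real_derivative D) (at 0) \<Longrightarrow> pd k g y = D"
  unfolding pd_def by (rule DERIV_imp_deriv)

lemma quad_form_line:
  fixes P :: "real^'m::finite^'m"
  assumes "transpose P = P"
  shows "quad_form (q + s *\<^sub>R e) P = quad_form q P + s * (2 * (e \<bullet> (P *v q))) + s\<^sup>2 * quad_form e P"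
proof -
  have "q \<bullet> (P *v e) = e \<bullet> (P *v q)"
    using assms by (metis inner_commute inner_matrix_vector_transpose)
  then show ?thesis
    by (simp add: quad_form_def matrix_vector_right_distrib matrix_vector_mult_scaleR
        inner_add_left inner_add_right algebra_simps power2_eq_square)
qed

lemma has_real_derivative_Phi_line:
  fixes C :: "real^('n::finite \<times> 'd::finite)^('n \<times> 'd)"
  assumes "C \<in> Zset"
  shows "((\<lambda>s. Phi C (q + s *\<^sub>R e)) has_real_derivative - (e \<bullet> (matrix_inv C *v q)) * Phi C q) (at 0)"
proof -
  let ?P = "matrix_inv C"
  have "((\<lambda>s. quad_form q ?P + s * (2 * (e \<bullet> (?P *v q))) + s\<^sup>2 * quad_form e ?P)
      has_real_derivative 2 * (e \<bullet> (?P *v q))) (at 0)"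
    by (auto intro!: derivative_eq_intros)
  then have "((\<lambda>s. quad_form (q + s *\<^sub>R e) ?P) has_real_derivative 2 * (e \<bullet> (?P *v q))) (at 0)"
    by (simp add: quad_form_line Zset_matrix_inv_symmetric[OF assms])
  then have "((\<lambda>s. exp (- quad_form (q + s *\<^sub>R e) ?P / 2) / sqrt ((2 * pi) ^ CARD('n \<times> 'd) * det C))
      has_real_derivative exp (- quad_form (q + 0 *\<^sub>R e) ?P / 2) * (- (2 * (e \<bullet> (?P *v q))) / 2)
        / sqrt ((2 * pi) ^ CARD('n \<times> 'd) * det C)) (at 0)"
    by (intro DERIV_cdivide DERIV_fun_exp DERIV_minus)
  then show ?thesis
    unfolding Phi_eq by (simp add: mult_ac)
qed

lemma grad_Phi:
  fixes C :: "real^('n::finite \<times> 'd::finite)^('n \<times> 'd)"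
  assumes "C \<in> Zset"
  shows "grad (Phi C) q = (- Phi C q) *\<^sub>R (matrix_inv C *v q)"
proof -
  have "pd k (Phi C) q = - (matrix_inv C *v q) $ k * Phi C q" for k
    using pd_eqI[OF has_real_derivative_Phi_line[OF assms, of q "axis k 1"]] by (simp add: inner_axis')
  then show ?thesis by (simp add: grad_def vec_eq_iff)
qed

lemma pd_matrix_vector_Phi:
  fixes C G :: "real^('n::finite \<times> 'd::finite)^('n \<times> 'd)"
  assumes "C \<in> Zset"
  shows "pd k (\<lambda>q'. (G *v q') $ k * Phi C q') q =
    G $ k $ k * Phi C q - (G *v q) $ k * (matrix_inv C *v q) $ k * Phi C q"
proof (rule pd_eqI)
  have "((\<lambda>s. (G *v q) $ k + s * (G *v axis k 1) $ k) has_real_derivative (G *v axis k 1) $ k) (at 0)"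
    by (auto intro!: derivative_eq_intros)
  moreover have "(G *v axis k 1) $ k = G $ k $ k"
    using inner_axis_matrix_axis[of k G k] by (simp add: inner_axis')
  ultimately have "((\<lambda>s. (G *v (q + s *\<^sub>R axis k 1)) $ k) has_real_derivative G $ k $ k) (at 0)"
    by (simp add: matrix_vector_right_distrib matrix_vector_mult_scaleR)
  from DERIV_mult'[OF this has_real_derivative_Phi_line[OF assms]]
  show "((\<lambda>s. (G *v (q + s *\<^sub>R axis k 1)) $ k * Phi C (q + s *\<^sub>R axis k 1)) has_real_derivative
      G $ k $ k * Phi C q - (G *v q) $ k * (matrix_inv C *v q) $ k * Phi C q) (at 0)"
    by (rule DERIV_cong) (simp add: inner_axis' algebra_simps)
qed

lemma div_Phi_flux:
  fixes C G :: "real^('n::finite \<times> 'd::finite)^('n \<times> 'd)"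
  assumes "C \<in> Zset"
  shows "- (\<Sum>k\<in>UNIV. pd k (\<lambda>q'. (G *v q') $ k * Phi C q') q)
    = ((G *v q) \<bullet> (matrix_inv C *v q) - trace G) * Phi C q"
  unfolding pd_matrix_vector_Phi[OF assms]
  by (simp add: trace_def inner_vec_def sum_subtractf sum_distrib_left algebra_simps)

lemma log_Phi_deriv_symmetrize:
  assumes "C \<in> Zset"
  shows "log_Phi_deriv C (G ** C + C ** transpose G) q
    = (G *v q) \<bullet> (matrix_inv C *v q) - trace G"
proof -
  let ?P = "matrix_inv C"
  have inv: "?P ** C = mat 1" "C ** ?P = mat 1" using Zset_matrix_inv[OF assms] by auto
  have sym: "transpose ?P = ?P" using Zset_matrix_inv_symmetric[OF assms] .
  have "?P ** (G ** C + C ** transpose G) ** ?P = ?P ** G + transpose G ** ?P"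
    by (simp add: matrix_add_ldistrib matrix_add_rdistrib matrix_mul_assoc[symmetric] inv(2)
        matrix_inv_cancel(2)[OF inv])
  also have "\<dots> = ?P ** G + transpose (?P ** G)"
    by (simp add: matrix_transpose_mul sym)
  finally have "quad_form q (?P ** (G ** C + C ** transpose G) ** ?P) = 2 * quad_form q (?P ** G)"
    by (simp add: quad_form_add quad_form_transpose)
  moreover have "quad_form q (?P ** G) = (G *v q) \<bullet> (?P *v q)"
  proof -
    have "q \<bullet> (?P *v (G *v q)) = (?P *v q) \<bullet> (G *v q)"
      using inner_matrix_vector_transpose[of q ?P "G *v q"] by (simp only: sym)
    then show ?thesis by (simp add: quad_form_def matrix_vector_mul_assoc inner_commute)
  qed
  moreover have "trace (?P ** (G ** C + C ** transpose G)) = 2 * trace G"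
  proof -
    have "trace (?P ** (G ** C)) = trace G"
      by (simp add: trace_mul_sym[of ?P] matrix_mul_assoc[symmetric] inv(2))
    then show ?thesis
      by (simp add: matrix_add_ldistrib trace_add matrix_inv_cancel(2)[OF inv] trace_transpose)
  qed
  ultimately show ?thesis by (simp add: log_Phi_deriv_def)
qed

lemma transpose_kron_I: "transpose (kron_I L :: real^('n::finite \<times> 'd::finite)^('n \<times> 'd)) = kron_I (transpose L)"
  by (simp add: vec_eq_iff kron_I_def transpose_def)

lemma transpose_diag_mat: "transpose (diag_mat v) = diag_mat v"
  by (simp add: vec_eq_iff diag_mat_def transpose_def)

lemma kron_I_diag_mat_Ztilde: "(kron_I (diag_mat v) :: real^('n::finite \<times> 'd::finite)^('n \<times> 'd)) \<in> Ztilde"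
  by (auto simp: Ztilde_def block_diag_def kron_I_def diag_mat_def transpose_def vec_eq_iff)

lemma block_diag_Mmat: "block_diag (Mmat De (diag_mat v) u t x)"
  by (simp add: Mmat_def block_diag_def kron_I_def diag_mat_def I_kron_def)

lemma Ztilde_symmetrize: "block_diag M \<Longrightarrow> S \<in> Ztilde \<Longrightarrow> M ** S + S ** transpose M \<in> Ztilde"
  by (simp add: Ztilde_def block_diag_add block_diag_mult block_diag_transpose transpose_add
      matrix_transpose_mul add.commute)

lemma Aq_eq_tangent_matrix:
  "Aq De \<Lambda> u t C x = tangent_matrix (C x)
     (Mmat De \<Lambda> u t x ** C x + C x ** transpose (Mmat De \<Lambda> u t x) - (1 / De) *\<^sub>R kron_I \<Lambda>)"
  by (simp add: Aq_def tangent_matrix_def)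

lemma Aq_Ztilde: "C x \<in> Zset \<Longrightarrow> Aq De (diag_mat v) u t C x \<in> Ztilde"
  unfolding Aq_eq_tangent_matrix
  by (intro tangent_matrix_Ztilde Ztilde_diff Ztilde_symmetrize Ztilde_scaleR block_diag_Mmat
      kron_I_diag_mat_Ztilde Zset_Ztilde)

lemma Lq_Phi:
  fixes C :: "real^'d::finite \<Rightarrow> real^('n::finite \<times> 'd)^('n \<times> 'd)"
  assumes C: "C x \<in> Zset" and f: "\<And>q. f (x,q) = Phi (C x) q" and \<Lambda>: "transpose \<Lambda> = \<Lambda>"
  shows "Lq De \<Lambda> u t f (x,q) = (q \<bullet> (Aq De \<Lambda> u t C x *v q) - trace (Aq De \<Lambda> u t C x ** C x)) * f (x,q)"
proof -
  let ?M = "Mmat De \<Lambda> u t x" and ?K = "kron_I \<Lambda> :: real^('n \<times> 'd)^('n \<times> 'd)"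
  let ?P = "matrix_inv (C x)" and ?c = "1 / (2 * De)"
  define G where "G = ?M - ?c *\<^sub>R (?K ** ?P)"
  have "(\<lambda>q''. f (x,q'')) = Phi (C x)" by (simp add: f)
  then have flux: "(\<lambda>q'. (?M *v q') $ k * f (x,q') + ?c * (?K *v grad (\<lambda>q''. f (x,q'')) q') $ k)
      = (\<lambda>q'. (G *v q') $ k * Phi (C x) q')" for k
    by (simp add: grad_Phi[OF C] G_def f matrix_vector_mult_diff_rdistrib matrix_vector_mult_scaleR
        matrix_vector_mult_uminus_right
        scaleR_matrix_vector_assoc[symmetric] matrix_vector_mul_assoc[symmetric] algebra_simps)
  have "(1 / De) *\<^sub>R ?K = ?c *\<^sub>R ?K + ?c *\<^sub>R ?K"
    by (simp flip: scaleR_add_left)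
  then have "G ** C x + C x ** transpose G = ?M ** C x + C x ** transpose ?M - (1 / De) *\<^sub>R ?K"
    using Zset_matrix_inv[OF C] Zset_matrix_inv_symmetric[OF C] \<Lambda>
    by (simp add: G_def matrix_diff_ldistrib matrix_diff_rdistrib transpose_diff transpose_scalar
        matrix_transpose_mul transpose_kron_I matrix_scaleR_left matrix_scaleR_right
        matrix_inv_cancel(2,3) scaleR_diff_right algebra_simps)
  then have Aq: "Aq De \<Lambda> u t C x = tangent_matrix (C x) (G ** C x + C x ** transpose G)"
    by (simp add: Aq_eq_tangent_matrix)
  have "Lq De \<Lambda> u t f (x,q) = - (\<Sum>k\<in>UNIV. pd k (\<lambda>q'. (G *v q') $ k * Phi (C x) q') q)"
    unfolding Lq_def Let_def fst_conv snd_conv flux ..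
  also have "\<dots> = ((G *v q) \<bullet> (?P *v q) - trace G) * Phi (C x) q"
    by (rule div_Phi_flux[OF C])
  also have "\<dots> = (q \<bullet> (Aq De \<Lambda> u t C x *v q) - trace (Aq De \<Lambda> u t C x ** C x)) * f (x,q)"
    by (simp add: Aq tangent_matrix_factor[OF C] log_Phi_deriv_symmetrize[OF C] f)
  finally show ?thesis .
qed

section \<open>The spatial operator\<close>

lemma eventually_line_in_open:
  fixes y :: "'a::real_normed_vector"
  assumes "open \<Omega>" "y \<in> \<Omega>"
  shows "eventually (\<lambda>s. y + s *\<^sub>R e \<in> \<Omega>) (nhds 0)"
proof -
  have "open ((\<lambda>s::real. y + s *\<^sub>R e) -` \<Omega>)"
    by (rule continuous_open_vimage[OF assms(1)]) (intro continuous_intros)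
  then show ?thesis using assms(2) unfolding eventually_nhds by force
qed

lemma pd_cong_open:
  assumes "open \<Omega>" "y \<in> \<Omega>" "\<And>z. z \<in> \<Omega> \<Longrightarrow> g z = h z"
  shows "pd a g y = pd a h y"
  unfolding pd_def
proof (rule deriv_cong_ev)
  show "eventually (\<lambda>s. g (y + s *\<^sub>R axis a 1) = h (y + s *\<^sub>R axis a 1)) (nhds 0)"
    using eventually_line_in_open[OF assms(1,2), where e = "axis a 1"]
    by (rule eventually_mono) (simp add: assms(3))
qed simp

lemma dmat_cong_open:
  assumes "open \<Omega>" "y \<in> \<Omega>" "\<And>z. z \<in> \<Omega> \<Longrightarrow> G z = H z"
  shows "dmat a G y = dmat a H y"
proof -
  have "pd a (\<lambda>z. G z $ i $ j) y = pd a (\<lambda>z. H z $ i $ j) y" for i j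
    by (rule pd_cong_open[OF assms(1,2)]) (simp add: assms(3))
  then show ?thesis by (simp add: dmat_def)
qed

lemma dmat_Ztilde:
  assumes "open \<Omega>" "y \<in> \<Omega>" "\<And>z. z \<in> \<Omega> \<Longrightarrow> G z \<in> Ztilde"
  shows "dmat a G y \<in> Ztilde"
proof -
  have "dmat a G y $ (i,b) $ (j,c) = 0" if "i \<noteq> j" for i b j c
  proof -
    have "pd a (\<lambda>z. G z $ (i,b) $ (j,c)) y = pd a (\<lambda>z. 0) y"
    proof (rule pd_cong_open[OF assms(1,2)])
      fix z assume "z \<in> \<Omega>"
      then have "block_diag (G z)" using assms(3) by (simp add: Ztilde_def)
      then show "G z $ (i,b) $ (j,c) = 0" using that unfolding block_diag_def by blast
    qed
    then show ?thesis by (simp add: dmat_def pd_def)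
  qed
  then have "block_diag (dmat a G y)" by (simp add: block_diag_def)
  moreover have "pd a (\<lambda>z. G z $ p $ r) y = pd a (\<lambda>z. G z $ r $ p) y" for p r
  proof (rule pd_cong_open[OF assms(1,2)])
    fix z assume "z \<in> \<Omega>"
    then have "transpose (G z) $ r $ p = G z $ r $ p" using assms(3) by (simp add: Ztilde_def)
    then show "G z $ p $ r = G z $ r $ p" by (simp add: transpose_def)
  qed
  then have "transpose (dmat a G y) = dmat a G y" by (simp add: vec_eq_iff dmat_def transpose_def)
  ultimately show ?thesis by (simp add: Ztilde_def)
qed

lemma has_matrix_derivative_line:
  fixes g :: "real^'d::finite \<Rightarrow> real^'n::finite^'m::finite"
  assumes "g differentiable (at y)"
  shows "has_matrix_derivative (\<lambda>s. g (y + s *\<^sub>R e)) (frechet_derivative g (at y) e) 0"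
  unfolding has_matrix_derivative_def
proof (intro allI)
  fix i j
  let ?G = "frechet_derivative g (at y)"
  have G: "(g has_derivative ?G) (at y)"
    by (rule frechet_derivative_works[THEN iffD1, OF assms])
  then have G0: "(g has_derivative ?G) (at ((\<lambda>s. y + s *\<^sub>R e) 0))" by simp
  have "((\<lambda>s. y + s *\<^sub>R e) has_derivative (\<lambda>h. h *\<^sub>R e)) (at 0)"
    by (auto intro!: derivative_eq_intros)
  from diff_chain_at[OF this G0]
  have "((\<lambda>s. g (y + s *\<^sub>R e)) has_derivative (\<lambda>h. ?G (h *\<^sub>R e))) (at 0)"
    by (simp add: o_def)
  then have "((\<lambda>s. g (y + s *\<^sub>R e) $ i $ j) has_derivative (\<lambda>h. ?G (h *\<^sub>R e) $ i $ j)) (at 0)"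
    using bounded_linear.has_derivative[OF bounded_linear_compose[OF bounded_linear_vec_nth
          bounded_linear_vec_nth]] by blast
  moreover have "(\<lambda>h. ?G (h *\<^sub>R e) $ i $ j) = (\<lambda>h. ?G e $ i $ j * h)"
    using linear_scale[OF has_derivative_linear[OF G]]
    by (auto simp: mult.commute)
  ultimately show "((\<lambda>s. g (y + s *\<^sub>R e) $ i $ j) has_real_derivative ?G e $ i $ j) (at 0)"
    by (simp add: has_field_derivative_def)
qed

lemma dmat_eq_frechet_derivative:
  assumes "g differentiable (at y)"
  shows "dmat a g y = frechet_derivative g (at y) (axis a 1)"
proof -
  have "pd a (\<lambda>x'. g x' $ i $ j) y = frechet_derivative g (at y) (axis a 1) $ i $ j" for i j
    by (rule pd_eqI)
      (use has_matrix_derivative_line[OF assms, of "axis a 1"] in \<open>simp add: has_matrix_derivative_def\<close>)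
  then show ?thesis by (simp add: dmat_def vec_eq_iff)
qed

lemma has_matrix_derivative_dmat:
  "g differentiable (at y) \<Longrightarrow> has_matrix_derivative (\<lambda>s. g (y + s *\<^sub>R axis a 1)) (dmat a g y) 0"
  unfolding dmat_eq_frechet_derivative by (rule has_matrix_derivative_line)

lemma smooth_on_differentiable_on:
  fixes C :: "real^'d::finite \<Rightarrow> 'b::euclidean_space"
  assumes "smooth_on \<Omega> C"
  shows "C differentiable_on \<Omega>"
    and "(\<lambda>z. frechet_derivative C (at z) (axis a 1)) differentiable_on \<Omega>"
proof -
  have C2: "Ck (Suc (Suc 0)) \<Omega> C" using assms unfolding smooth_on_def by blast
  then show "C differentiable_on \<Omega>" by simp
  have "(axis a 1 :: real^'d) \<in> Basis" by simp
  with C2 show "(\<lambda>z. frechet_derivative C (at z) (axis a 1)) differentiable_on \<Omega>" by auto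
qed

lemma has_matrix_derivative_dmat_dmat:
  assumes "open \<Omega>" "smooth_on \<Omega> C" "x \<in> \<Omega>"
  shows "has_matrix_derivative (\<lambda>s. dmat a C (x + s *\<^sub>R axis a 1)) (dmat a (dmat a C) x) 0"
proof -
  define F where "F z = frechet_derivative C (at z) (axis a 1)" for z
  have F: "dmat a C z = F z" if "z \<in> \<Omega>" for z
    using smooth_on_differentiable_on(1)[OF assms(2)] assms(1) that
    by (simp add: F_def dmat_eq_frechet_derivative differentiable_on_eq_differentiable_at)
  have "F differentiable (at x)"
    using smooth_on_differentiable_on(2)[OF assms(2)] assms(1,3)
    by (simp add: F_def[abs_def] differentiable_on_eq_differentiable_at)
  from has_matrix_derivative_dmat[OF this]
  have "has_matrix_derivative (\<lambda>s. F (x + s *\<^sub>R axis a 1)) (dmat a (dmat a C) x) 0"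
    using dmat_cong_open[OF assms(1,3) F] by simp
  moreover have "eventually (\<lambda>s. F (x + s *\<^sub>R axis a 1) = dmat a C (x + s *\<^sub>R axis a 1)) (nhds 0)"
    using eventually_line_in_open[OF assms(1,3), where e = "axis a 1"]
    by (rule eventually_mono) (simp add: F)
  ultimately show ?thesis
    by (rule has_matrix_derivative_cong_ev[rotated])
qed

lemma Lx_mat_eq:
  "Lx_mat u \<epsilon> t C x = (\<Sum>a\<in>UNIV. u t x $ a *\<^sub>R dmat a C x) - \<epsilon> *\<^sub>R (\<Sum>a\<in>UNIV. dmat a (dmat a C) x)"
  by (simp add: Lx_mat_def dmat_def vec_eq_iff inner_vec_def grad_def lap_def sum_component)

lemma Ax_eq_tangent_matrix: "Ax u \<epsilon> t C x = tangent_matrix (C x) (Lx_mat u \<epsilon> t C x)"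
  by (simp add: Ax_def tangent_matrix_def)

lemma Ax_Ztilde:
  assumes "open \<Omega>" "\<And>y. y \<in> \<Omega> \<Longrightarrow> C y \<in> Zset" "x \<in> \<Omega>"
  shows "Ax u \<epsilon> t C x \<in> Ztilde"
proof -
  have "dmat a C y \<in> Ztilde" if "y \<in> \<Omega>" for a y
    using dmat_Ztilde[OF assms(1) that] assms(2) Zset_Ztilde by blast
  then have "dmat a (dmat a C) x \<in> Ztilde" "dmat a C x \<in> Ztilde" for a
    using dmat_Ztilde[OF assms(1,3)] assms(3) by blast+
  then show ?thesis
    unfolding Ax_eq_tangent_matrix Lx_mat_eq
    by (intro tangent_matrix_Ztilde assms Ztilde_diff Ztilde_scaleR Ztilde_sum)
qed

lemma pd_Phi_field:
  fixes C :: "real^'d::finite \<Rightarrow> real^('n::finite \<times> 'd)^('n \<times> 'd)"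
  assumes "open \<Omega>" "smooth_on \<Omega> C" "y \<in> \<Omega>" "C y \<in> Zset"
  shows "pd a (\<lambda>x'. Phi (C x') q) y = log_Phi_deriv (C y) (dmat a C y) q * Phi (C y) q"
proof -
  have "C differentiable (at y)"
    using smooth_on_differentiable_on(1)[OF assms(2)] assms(1,3)
    by (simp add: differentiable_on_eq_differentiable_at)
  from has_real_derivative_Phi[OF has_matrix_derivative_dmat[OF this]]
  show ?thesis using assms(4) by (intro pd_eqI) simp
qed

lemma has_real_derivative_log_Phi_deriv:
  assumes c': "has_matrix_derivative c c' s" and D': "has_matrix_derivative D D' s"
    and D: "D s = c'" and Z: "c s \<in> Zset"
  defines "P \<equiv> matrix_inv (c s)"
  shows "((\<lambda>r. log_Phi_deriv (c r) (D r) q) has_real_derivative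
    log_Phi_deriv (c s) D' q - quad_form q (P ** c' ** P ** c' ** P) + trace (P ** c' ** P ** c') / 2) (at s)"
proof -
  have P': "has_matrix_derivative (\<lambda>r. matrix_inv (c r)) (- (P ** c' ** P)) s"
    unfolding P_def by (rule has_matrix_derivative_matrix_inv[OF c' Zset_invertible[OF Z]])
  have PD: "has_matrix_derivative (\<lambda>r. matrix_inv (c r) ** D r) (- (P ** c' ** P) ** c' + P ** D') s"
    using has_matrix_derivative_mult[OF P' D'] D by (simp add: P_def)
  have "has_matrix_derivative (\<lambda>r. matrix_inv (c r) ** D r ** matrix_inv (c r))
      ((- (P ** c' ** P) ** c' + P ** D') ** P + P ** c' ** - (P ** c' ** P)) s"
    using has_matrix_derivative_mult[OF PD P'] D by (simp add: P_def)
  from has_real_derivative_quad_form[OF this] has_real_derivative_trace[OF PD]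
  have "((\<lambda>r. log_Phi_deriv (c r) (D r) q) has_real_derivative
      (quad_form q ((- (P ** c' ** P) ** c' + P ** D') ** P + P ** c' ** - (P ** c' ** P))
        - trace (- (P ** c' ** P) ** c' + P ** D')) / 2) (at s)"
    unfolding log_Phi_deriv_def by (intro DERIV_cdivide DERIV_diff)
  then show ?thesis
    unfolding P_def
    by (rule DERIV_cong) (simp only: log_Phi_deriv_def matrix_add_rdistrib matrix_add_ldistrib
        matrix_uminus_left matrix_uminus_right matrix_mul_assoc quad_form_add quad_form_uminus
        trace_add trace_uminus, simp add: field_simps)
qed

lemma rho_eq:
  fixes C :: "real^'d::finite \<Rightarrow> real^'m::finite^'m" and x :: "real^'d"
  defines "P \<equiv> matrix_inv (C x)"
  shows "rho C x q = (\<Sum>a\<in>UNIV. quad_form q (P ** dmat a C x ** P ** dmat a C x ** P)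
    - trace (P ** dmat a C x ** P ** dmat a C x) / 2 - (log_Phi_deriv (C x) (dmat a C x) q)\<^sup>2)"
  by (simp add: rho_def log_Phi_deriv_def P_def quad_form_def matrix_mul_assoc power_divide Let_def)

lemma pd_pd_Phi_field:
  fixes C :: "real^'d::finite \<Rightarrow> real^('n::finite \<times> 'd)^('n \<times> 'd)" and a :: 'd
  assumes \<Omega>: "open \<Omega>" and sm: "smooth_on \<Omega> C" and Z: "\<And>y. y \<in> \<Omega> \<Longrightarrow> C y \<in> Zset" and x: "x \<in> \<Omega>"
  defines "P \<equiv> matrix_inv (C x)" and "X \<equiv> dmat a C x"
  shows "pd a (pd a (\<lambda>x'. Phi (C x') q)) x = (log_Phi_deriv (C x) (dmat a (dmat a C) x) q
    - quad_form q (P ** X ** P ** X ** P) + trace (P ** X ** P ** X) / 2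
    + (log_Phi_deriv (C x) X q)\<^sup>2) * Phi (C x) q"
proof -
  let ?e = "axis a 1"
  have "pd a (pd a (\<lambda>x'. Phi (C x') q)) x
      = pd a (\<lambda>y. log_Phi_deriv (C y) (dmat a C y) q * Phi (C y) q) x"
    using pd_Phi_field[OF \<Omega> sm _ Z] by (intro pd_cong_open[OF \<Omega> x]) blast
  also have "\<dots> = (log_Phi_deriv (C x) (dmat a (dmat a C) x) q
      - quad_form q (P ** X ** P ** X ** P) + trace (P ** X ** P ** X) / 2
      + (log_Phi_deriv (C x) X q)\<^sup>2) * Phi (C x) q"
  proof (rule pd_eqI)
    have "C differentiable (at x)"
      using smooth_on_differentiable_on(1)[OF sm] \<Omega> x
      by (simp add: differentiable_on_eq_differentiable_at)
    then have c': "has_matrix_derivative (\<lambda>s. C (x + s *\<^sub>R ?e)) X 0"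
      unfolding X_def by (rule has_matrix_derivative_dmat)
    have D': "has_matrix_derivative (\<lambda>s. dmat a C (x + s *\<^sub>R ?e)) (dmat a (dmat a C) x) 0"
      by (rule has_matrix_derivative_dmat_dmat[OF \<Omega> sm x])
    from DERIV_mult'[OF has_real_derivative_log_Phi_deriv[OF c' D'] has_real_derivative_Phi[OF c']]
    show "((\<lambda>s. log_Phi_deriv (C (x + s *\<^sub>R ?e)) (dmat a C (x + s *\<^sub>R ?e)) q * Phi (C (x + s *\<^sub>R ?e)) q)
        has_real_derivative (log_Phi_deriv (C x) (dmat a (dmat a C) x) q
          - quad_form q (P ** X ** P ** X ** P) + trace (P ** X ** P ** X) / 2
          + (log_Phi_deriv (C x) X q)\<^sup>2) * Phi (C x) q) (at 0)"
      using Z[OF x] by (simp add: X_def P_def power2_eq_square algebra_simps)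
  qed
  finally show ?thesis .
qed

lemma Lx_Phi:
  fixes C :: "real^'d::finite \<Rightarrow> real^('n::finite \<times> 'd)^('n \<times> 'd)"
  assumes \<Omega>: "open \<Omega>" and sm: "smooth_on \<Omega> C" and Z: "\<And>y. y \<in> \<Omega> \<Longrightarrow> C y \<in> Zset"
    and f: "\<And>y q. y \<in> \<Omega> \<Longrightarrow> f (y,q) = Phi (C y) q" and x: "x \<in> \<Omega>"
  shows "Lx u \<epsilon> t f (x,q) = (q \<bullet> (Ax u \<epsilon> t C x *v q) - trace (Ax u \<epsilon> t C x ** C x)) * f (x,q)
    + \<epsilon> * rho C x q * f (x,q)"
proof -
  let ?F = "\<lambda>x'. f (x',q)" and ?\<phi> = "\<lambda>x'. Phi (C x') q" and ?l = "\<lambda>X. log_Phi_deriv (C x) X q"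
  let ?P = "matrix_inv (C x)"
  define \<rho> where "\<rho> a = quad_form q (?P ** dmat a C x ** ?P ** dmat a C x ** ?P)
    - trace (?P ** dmat a C x ** ?P ** dmat a C x) / 2 - (?l (dmat a C x))\<^sup>2" for a
  have F: "pd a ?F y = pd a ?\<phi> y" if "y \<in> \<Omega>" for a y
    using f that by (intro pd_cong_open[OF \<Omega>]) auto
  have d1: "pd a ?F x = ?l (dmat a C x) * Phi (C x) q" for a
    using F[OF x] pd_Phi_field[OF \<Omega> sm x Z[OF x]] by simp
  have d2: "pd a (pd a ?F) x = (?l (dmat a (dmat a C) x) - \<rho> a) * Phi (C x) q" for a
    using pd_cong_open[OF \<Omega> x F] pd_pd_Phi_field[OF \<Omega> sm Z x] by (simp add: \<rho>_def)
  have "Lx u \<epsilon> t f (x,q) = (\<Sum>a\<in>UNIV. u t x $ a * pd a ?F x) - \<epsilon> * (\<Sum>a\<in>UNIV. pd a (pd a ?F) x)"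
    by (simp add: Lx_def grad_def lap_def inner_vec_def)
  also have "\<dots> = (?l (\<Sum>a\<in>UNIV. u t x $ a *\<^sub>R dmat a C x) - \<epsilon> * ?l (\<Sum>a\<in>UNIV. dmat a (dmat a C) x))
      * Phi (C x) q + \<epsilon> * (\<Sum>a\<in>UNIV. \<rho> a) * Phi (C x) q"
    by (simp add: d1 d2 log_Phi_deriv_sum log_Phi_deriv_scaleR sum_distrib_left sum_distrib_right
        sum_subtractf algebra_simps)
  also have "\<dots> = ?l (Lx_mat u \<epsilon> t C x) * f (x,q) + \<epsilon> * rho C x q * f (x,q)"
    by (simp add: Lx_mat_eq log_Phi_deriv_diff log_Phi_deriv_scaleR rho_eq \<rho>_def f x)
  finally show ?thesis
    by (simp add: Ax_eq_tangent_matrix tangent_matrix_factor[OF Z[OF x]])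
qed

theorem lemma1:
  fixes \<Omega> :: "(real^'d) set"
    and \<Lambda> :: "real^('n::{finite,linorder})^('n::{finite,linorder})"
    and lam :: "real^('n::{finite,linorder})"
    and u :: "real \<Rightarrow> real^'d \<Rightarrow> real^'d"
    and C :: "real^'d \<Rightarrow> real^(('n::{finite,linorder}) \<times> 'd)^(('n::{finite,linorder}) \<times> 'd)"
    and f :: "((real^'d) \<times> (real^(('n::{finite,linorder}) \<times> 'd))) \<Rightarrow> real"
    and De \<epsilon> t :: real
  assumes dom: "lipschitz_domain \<Omega>" "bounded \<Omega>"
    and Lam: "\<Lambda> = diag_mat lam" "\<exists>Q. orthogonal_matrix Q \<and> rouse = transpose Q ** \<Lambda> ** Q"
    and De: "De > 0" and eps: "\<epsilon> \<ge> 0"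
    and u: "smooth_on \<Omega> (u t)"
    and C: "\<forall>x\<in>\<Omega>. C x \<in> Zset" "smooth_on \<Omega> C"
    and f: "f \<in> M_Phi \<Omega>" "\<forall>x\<in>\<Omega>. \<forall>q. f (x,q) = Phi (C x) q"
  shows
    "(tangent_space \<Omega> f =
       {\<phi> \<in> Hspace \<Omega>. \<exists>A. (\<forall>x\<in>\<Omega>. A x \<in> Ztilde) \<and>
          (\<forall>x\<in>\<Omega>. \<forall>q. \<phi> (x,q) = (q \<bullet> (A x *v q) - trace (A x ** C x)) * f (x,q))}) \<and>
    ((\<forall>x\<in>\<Omega>. Aq De \<Lambda> u t C x \<in> Ztilde) \<and>
     (\<forall>x\<in>\<Omega>. \<forall>q. Lq De \<Lambda> u t f (x,q) =
        (q \<bullet> (Aq De \<Lambda> u t C x *v q) - trace (Aq De \<Lambda> u t C x ** C x)) * f (x,q)) \<and>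
     (Lq De \<Lambda> u t f \<in> Hspace \<Omega> \<longrightarrow> Lq De \<Lambda> u t f \<in> tangent_space \<Omega> f)) \<and>
    ((\<forall>x\<in>\<Omega>. Ax u \<epsilon> t C x \<in> Ztilde) \<and>
     (\<forall>x\<in>\<Omega>. \<forall>q. Lx u \<epsilon> t f (x,q) =
        (q \<bullet> (Ax u \<epsilon> t C x *v q) - trace (Ax u \<epsilon> t C x ** C x)) * f (x,q)
        + \<epsilon> * rho C x q * f (x,q)) \<and>
     (\<epsilon> = 0 \<and> Lx u \<epsilon> t f \<in> Hspace \<Omega> \<longrightarrow> Lx u \<epsilon> t f \<in> tangent_space \<Omega> f))"
proof -
  have \<Omega>: "open \<Omega>" using dom(1) unfolding lipschitz_domain_def by blast
  have Aq: "\<forall>x\<in>\<Omega>. Aq De \<Lambda> u t C x \<in> Ztilde"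
    using Aq_Ztilde C(1) Lam(1) by blast
  have Lq: "\<forall>x\<in>\<Omega>. \<forall>q. Lq De \<Lambda> u t f (x,q) =
      (q \<bullet> (Aq De \<Lambda> u t C x *v q) - trace (Aq De \<Lambda> u t C x ** C x)) * f (x,q)"
    using Lq_Phi[where \<Lambda> = \<Lambda>] transpose_diag_mat C(1) f(2) Lam(1) by blast
  have Ax: "\<forall>x\<in>\<Omega>. Ax u \<epsilon> t C x \<in> Ztilde"
    using Ax_Ztilde[OF \<Omega>] C(1) by blast
  have Lx: "\<forall>x\<in>\<Omega>. \<forall>q. Lx u \<epsilon> t f (x,q) =
      (q \<bullet> (Ax u \<epsilon> t C x *v q) - trace (Ax u \<epsilon> t C x ** C x)) * f (x,q) + \<epsilon> * rho C x q * f (x,q)"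
    using Lx_Phi[OF \<Omega> C(2)] C(1) f(2) by blast
  have "Lx u \<epsilon> t f \<in> tangent_space \<Omega> f" if "\<epsilon> = 0" "Lx u \<epsilon> t f \<in> Hspace \<Omega>"
    using tangent_spaceI[OF C(1) f(2) that(2) Ax] Lx that(1) by simp
  then show ?thesis
    using tangent_space_eq[OF C(1) f(2)] tangent_spaceI[OF C(1) f(2) _ Aq Lq] Aq Lq Ax Lx by blast
qed

end
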